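(* Let $\langle\mathcal S,\mathcal A,\mathcal P,\mathcal R,\gamma\rangle$ be a discounted Markov decision process with $\gamma\in(0,1)$, let $\alpha>0$, and let $\pi$ be a stationary policy. Assume: (a) for each $s\in\mathcal S$, if $a\sim\pi(\cdot\mid s)$, then $\log\pi(a\mid s)$ is well defined almost surely; (b) $\sup_{(s,a)\in\mathcal S\times\mathcal A}\mathbb E_{r\sim R(s,a),\,(s',a')\sim\mathcal P^\pi(\cdot\mid s,a)}\bigl[|r-\gamma\alpha\log\pi(a'\mid s')|\bigr]<\infty$; (c) for every $F\in\mathcal X^{\mathrm{cdf}}$ and $x\in\mathbb R$, the map $(s,a)\mapsto\mathbb E_{r\sim R(s,a),\,(s',a')\sim\mathcal P^\pi(\cdot\mid s,a)}\bigl[F(s',a')\bigl(\tfrac{x-r}{\gamma}+\alpha\log\pi(a'\mid s')\bigr)\bigr]$ is measurable; (d) the CDF field of the policy-induced soft return-distribution field $\mathcal Z^\pi$ satisfies $F_{\mathcal Z^\pi}\in\mathcal X^{\mathrm{cdf}}$. Let $F_0\in\mathcal X^{\mathrm{cdf}}$ be arbitrary and define $F_{k+1}=\mathcal T^\pi_{\mathrm{cdf}}F_k$ for $k\ge0$. Then $F_{\mathcal Z^\pi}$ is the unique fixed point of $\mathcal T^\pi_{\mathrm{cdf}}$ in $\mathcal X^{\mathrm{cdf}}$, $F_k\to F_{\mathcal Z^\pi}$ in $(\mathcal X^{\mathrm{cdf}},d_{\mathrm{Cr}})$, and for every $k\ge0$, $$d_{\mathrm{Cr}}(F_k,F_{\mathcal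 Z^\pi})\le(\sqrt\gamma)^k\,d_{\mathrm{Cr}}(F_0,F_{\mathcal Z^\pi}).$$
   Context: MDP: $\mathcal S,\mathcal A$ are measurable spaces (states, actions), $\mathcal P(\cdot\mid s,a)$ is a transition kernel on $\mathcal S$, $\mathcal R:\mathcal S\times\mathcal A\times\mathcal S\to\mathbb R$ is a (measurable) reward function. A stationary policy $\pi$ assigns to each $s$ a probability distribution $\pi(\cdot\mid s)$ on $\mathcal A$; $\pi(a\mid s)$ denotes the value of its probability mass function / density. Sampling: $(s',a')\sim\mathcal P^\pi(\cdot\mid s,a)$ means $s'\sim\mathcal P(\cdot\mid s,a)$ and then $a'\sim\pi(\cdot\mid s')$; $r\sim R(s,a)$ denotes the one-step reward $r=\mathcal R(s,a,s')$ generated by the same next state $s'$. Soft return: for the trajectory with $S_{t+1}\sim\mathcal P(\cdot\mid S_t,A_t)$, $R_t=\mathcal R(S_t,A_t,S_{t+1})$ and subsequent actions drawn from $\pi$, $Z^\pi(s,a)$ is $Z_t^\pi:=R_t+\sum_{k\ge1}\gamma^k[R_{t+k}-\alpha\log\pi(A_{t+k}\mid S_{t+k})]$ (series assumed almost surely convergent) conditioned on $(S_t,A_t)=(s,a)$; its law does not depend on $t$. Put $\mathcal Z^\pi(s,a):=\mathrm{Law}(Z^\pi(s,a))$, and let $F_{\mathcal Z^\pi}(s,a)$ be the CDF of $\mathcal Z^\pi(s,a)$. It satisfies the Bellman equation $Z^\pi(s,a)=R(s,a)+\gamma(Z^\pi(s',a')-\alpha\log\pi(a'\mid s'))$ in law,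 with $(s',a')\sim\mathcal P^\pi(\cdot\mid s,a)$ and $R(s,a)$ the one-step reward. Cramér distance between laws on $\mathbb R$: $d_C(P_1,P_2)=\bigl(\int_{\mathbb R}(F_{P_1}(x)-F_{P_2}(x))^2dx\bigr)^{1/2}$. $\delta_0$ is the Dirac law at $0$. $\Gamma_F$ is the set of CDFs $F_P$ of laws $P$ on $\mathbb R$ with $d_C(P,\delta_0)<\infty$. $\mathcal X^{\mathrm{cdf}}$ is the set of all CDF fields $F:(s,a)\mapsto F(s,a)\in\Gamma_F$ (with $(s,a)\mapsto F(s,a)(x)$ measurable for each $x\in\mathbb R$) such that $\sup_{(s,a)}\int_{\mathbb R}(F(s,a)(x)-\mathbf 1\{x\ge0\})^2dx<\infty$. Metric: $d_{\mathrm{Cr}}(F_1,F_2):=\sup_{(s,a)}\bigl(\int_{\mathbb R}(F_1(s,a)(x)-F_2(s,a)(x))^2dx\bigr)^{1/2}$. Operator: for $F\in\mathcal X^{\mathrm{cdf}}$, $(\mathcal T^\pi_{\mathrm{cdf}}F)(s,a)(x):=\mathbb E_{r\sim R(s,a),\,(s',a')\sim\mathcal P^\pi(\cdot\mid s,a)}\bigl[F(s',a')\bigl(\tfrac{x-r}{\gamma}+\alpha\log\pi(a'\mid s')\bigr)\bigr]$. *)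

theory Defs
  imports "HOL-Probability.Probability"
begin

section \<open>Discounted Markov decision processes and stationary policies\<close>

definition discounted_mdp ::
  "'s measure \<Rightarrow> 'a measure \<Rightarrow> ('s \<times> 'a \<Rightarrow> 's measure) \<Rightarrow> ('s \<Rightarrow> 'a \<Rightarrow> 's \<Rightarrow> real) \<Rightarrow> real \<Rightarrow> bool"
where
  "discounted_mdp S A P R \<gamma> \<longleftrightarrow>
     P \<in> S \<Otimes>\<^sub>M A \<rightarrow>\<^sub>M prob_algebra S \<and>
     (\<lambda>(s, a, s'). R s a s') \<in> borel_measurable (S \<Otimes>\<^sub>M A \<Otimes>\<^sub>M S) \<and>
     0 < \<gamma> \<and> \<gamma> < 1"

text \<open>
  The number \<open>p s a\<close> is the value of the density of \<open>\<pi> s\<close> at \<open>a\<close> with respect to a reference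
  measure \<open>\<mu>\<close> on the action space. Probability mass functions are the case where \<open>\<mu>\<close> is the
  counting measure; in particular \<open>\<mu>\<close> need not be sigma-finite.
\<close>

definition stationary_policy ::
  "'s measure \<Rightarrow> 'a measure \<Rightarrow> 'a measure \<Rightarrow> ('s \<Rightarrow> 'a measure) \<Rightarrow> ('s \<Rightarrow> 'a \<Rightarrow> real) \<Rightarrow> bool"
where
  "stationary_policy S A \<mu> \<pi> p \<longleftrightarrow>
     sets \<mu> = sets A \<and>
     \<pi> \<in> S \<rightarrow>\<^sub>M prob_algebra A \<and>
     (\<lambda>(s, a). p s a) \<in> borel_measurable (S \<Otimes>\<^sub>M A) \<and>
     (\<forall>s\<in>space S. (\<forall>a\<in>space A. 0 \<le> p s a) \<and> \<pi> s = density \<mu> (\<lambda>a. ennreal (p s a)))"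

definition next_law ::
  "'s measure \<Rightarrow> 'a measure \<Rightarrow> ('s \<times> 'a \<Rightarrow> 's measure) \<Rightarrow> ('s \<Rightarrow> 'a measure) \<Rightarrow> 's \<times> 'a \<Rightarrow> ('s \<times> 'a) measure"
where
  "next_law S A P \<pi> sa = P sa \<bind> (\<lambda>s'. \<pi> s' \<bind> (\<lambda>a'. return (S \<Otimes>\<^sub>M A) (s', a')))"


section \<open>The soft return\<close>

definition traj_kernel ::
  "'s measure \<Rightarrow> 'a measure \<Rightarrow> ('s \<times> 'a \<Rightarrow> 's measure) \<Rightarrow> ('s \<Rightarrow> 'a measure) \<Rightarrow> 's \<times> 'a
    \<Rightarrow> nat \<Rightarrow> (nat \<Rightarrow> 's \<times> 'a) \<Rightarrow> ('s \<times> 'a) measure"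
where
  "traj_kernel S A P \<pi> sa n \<omega> =
     (case n of 0 \<Rightarrow> return (S \<Otimes>\<^sub>M A) sa | Suc m \<Rightarrow> next_law S A P \<pi> (\<omega> m))"

text \<open>
  The law of the state-action trajectory started in the state-action pair \<open>sa\<close>: the measure on
  the product space given by the Ionescu-Tulcea theorem for the kernels \<open>traj_kernel\<close>.
\<close>

definition trajectory_law ::
  "'s measure \<Rightarrow> 'a measure \<Rightarrow> ('s \<times> 'a \<Rightarrow> 's measure) \<Rightarrow> ('s \<Rightarrow> 'a measure) \<Rightarrow> 's \<times> 'a
    \<Rightarrow> (nat \<Rightarrow> 's \<times> 'a) measure"
where
  "trajectory_law S A P \<pi> sa =
     projective_family.lim UNIV
       (Ionescu_Tulcea.CI (traj_kernel S A P \<pi> sa) (\<lambda>_. S \<Otimes>\<^sub>M A)) (\<lambda>_. S \<Otimes>\<^sub>M A)"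

definition traj_reward :: "('s \<Rightarrow> 'a \<Rightarrow> 's \<Rightarrow> real) \<Rightarrow> (nat \<Rightarrow> 's \<times> 'a) \<Rightarrow> nat \<Rightarrow> real"
where
  "traj_reward R \<omega> k = R (fst (\<omega> k)) (snd (\<omega> k)) (fst (\<omega> (Suc k)))"

text \<open>The summand with index \<open>k\<close> here is the one with exponent \<open>k + 1\<close> in the soft return.\<close>

definition soft_term ::
  "('s \<Rightarrow> 'a \<Rightarrow> 's \<Rightarrow> real) \<Rightarrow> real \<Rightarrow> real \<Rightarrow> ('s \<Rightarrow> 'a \<Rightarrow> real) \<Rightarrow> (nat \<Rightarrow> 's \<times> 'a) \<Rightarrow> nat \<Rightarrow> real"
where
  "soft_term R \<gamma> \<alpha> p \<omega> k =
     \<gamma> ^ Suc k * (traj_reward R \<omega> (Suc k) - \<alpha> * ln (p (fst (\<omega> (Suc k))) (snd (\<omega> (Suc k)))))"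

definition soft_return ::
  "('s \<Rightarrow> 'a \<Rightarrow> 's \<Rightarrow> real) \<Rightarrow> real \<Rightarrow> real \<Rightarrow> ('s \<Rightarrow> 'a \<Rightarrow> real) \<Rightarrow> (nat \<Rightarrow> 's \<times> 'a) \<Rightarrow> real"
where
  "soft_return R \<gamma> \<alpha> p \<omega> = traj_reward R \<omega> 0 + (\<Sum>k. soft_term R \<gamma> \<alpha> p \<omega> k)"

definition soft_return_law ::
  "'s measure \<Rightarrow> 'a measure \<Rightarrow> ('s \<times> 'a \<Rightarrow> 's measure) \<Rightarrow> ('s \<Rightarrow> 'a \<Rightarrow> 's \<Rightarrow> real) \<Rightarrow> real \<Rightarrow> real
    \<Rightarrow> ('s \<Rightarrow> 'a measure) \<Rightarrow> ('s \<Rightarrow> 'a \<Rightarrow> real) \<Rightarrow> 's \<times> 'a \<Rightarrow> real measure"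
where
  "soft_return_law S A P R \<gamma> \<alpha> \<pi> p sa =
     distr (trajectory_law S A P \<pi> sa) borel (soft_return R \<gamma> \<alpha> p)"


section \<open>The Cramer distance and CDF fields\<close>

definition esqrt :: "ennreal \<Rightarrow> ennreal"
where
  "esqrt x = (if x = \<infinity> then \<infinity> else ennreal (sqrt (enn2real x)))"

definition sq_dist :: "(real \<Rightarrow> real) \<Rightarrow> (real \<Rightarrow> real) \<Rightarrow> ennreal"
where
  "sq_dist f g = (\<integral>\<^sup>+ x. ennreal ((f x - g x)\<^sup>2) \<partial>lborel)"

definition cramer_dist :: "real measure \<Rightarrow> real measure \<Rightarrow> ennreal"
where
  "cramer_dist P1 P2 = esqrt (sq_dist (cdf P1) (cdf P2))"

definition Gamma_F :: "(real \<Rightarrow> real) set"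
where
  "Gamma_F = {cdf P | P. real_distribution P \<and> cramer_dist P (return borel 0) < \<infinity>}"

text \<open>
  Fields are extensional functions on the state-action space, so that equality of fields is
  equality at all state-action pairs.
\<close>

definition X_cdf :: "'s measure \<Rightarrow> 'a measure \<Rightarrow> ('s \<times> 'a \<Rightarrow> real \<Rightarrow> real) set"
where
  "X_cdf S A = {F \<in> space (S \<Otimes>\<^sub>M A) \<rightarrow>\<^sub>E Gamma_F.
     (\<forall>x. (\<lambda>sa. F sa x) \<in> borel_measurable (S \<Otimes>\<^sub>M A)) \<and>
     (SUP sa\<in>space (S \<Otimes>\<^sub>M A). sq_dist (F sa) (indicator {0..})) < \<infinity>}"

definition d_Cr ::
  "'s measure \<Rightarrow> 'a measure \<Rightarrow> ('s \<times> 'a \<Rightarrow> real \<Rightarrow> real) \<Rightarrow> ('s \<times> 'a \<Rightarrow> real \<Rightarrow> real) \<Rightarrow> ennreal"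
where
  "d_Cr S A F1 F2 = (SUP sa\<in>space (S \<Otimes>\<^sub>M A). esqrt (sq_dist (F1 sa) (F2 sa)))"

definition F_Z ::
  "'s measure \<Rightarrow> 'a measure \<Rightarrow> ('s \<times> 'a \<Rightarrow> 's measure) \<Rightarrow> ('s \<Rightarrow> 'a \<Rightarrow> 's \<Rightarrow> real) \<Rightarrow> real \<Rightarrow> real
    \<Rightarrow> ('s \<Rightarrow> 'a measure) \<Rightarrow> ('s \<Rightarrow> 'a \<Rightarrow> real) \<Rightarrow> 's \<times> 'a \<Rightarrow> real \<Rightarrow> real"
where
  "F_Z S A P R \<gamma> \<alpha> \<pi> p =
     (\<lambda>sa\<in>space (S \<Otimes>\<^sub>M A). cdf (soft_return_law S A P R \<gamma> \<alpha> \<pi> p sa))"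

definition T_cdf ::
  "'s measure \<Rightarrow> 'a measure \<Rightarrow> ('s \<times> 'a \<Rightarrow> 's measure) \<Rightarrow> ('s \<Rightarrow> 'a \<Rightarrow> 's \<Rightarrow> real) \<Rightarrow> real \<Rightarrow> real
    \<Rightarrow> ('s \<Rightarrow> 'a measure) \<Rightarrow> ('s \<Rightarrow> 'a \<Rightarrow> real)
    \<Rightarrow> ('s \<times> 'a \<Rightarrow> real \<Rightarrow> real) \<Rightarrow> 's \<times> 'a \<Rightarrow> real \<Rightarrow> real"
where
  "T_cdf S A P R \<gamma> \<alpha> \<pi> p F =
     (\<lambda>(s, a)\<in>space (S \<Otimes>\<^sub>M A). \<lambda>x.
        \<integral>(s', a'). F (s', a') ((x - R s a s') / \<gamma> + \<alpha> * ln (p s' a')) \<partial>next_law S A P \<pi> (s, a))"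

end

theory Submission
  imports Defs "HOL-Real_Asymp.Real_Asymp"
begin

text \<open>
  The operator averages the CDFs of the affine images \<open>c + \<gamma> Z\<close>, where \<open>c = r - \<gamma> \<alpha> ln \<pi>(a'|s')\<close>. Rescaling by \<open>\<gamma>\<close> multiplies the squared
  Cramer distance by \<open>\<gamma>\<close>, and averaging does not increase it by Jensen's inequality and Tonelli's
  theorem, so the operator contracts with factor \<open>sqrt \<gamma>\<close>. Comparing with the point mass at \<open>c\<close>, whose squared
  distance to the point mass at \<open>0\<close> is \<open>\<bar>c\<bar>\<close>, shows with (b) that it preserves the space of fields.
  That the return law is a fixed point is the Markov property of the trajectory at time one: given
  the second state-action pair, the shifted trajectory is a trajectory started there.
\<close>

section \<open>Distribution functions and the Cramer distance\<close>

text \<open>Removes the root, so that all estimates can be made on squared distances; with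
  \<open>D\<close> in \<open>ennreal\<close> it also covers infinite values.\<close>

lemma esqrt_le_iff: "esqrt x \<le> D \<longleftrightarrow> x \<le> D\<^sup>2"
proof (cases D)
  case (real d)
  show ?thesis
  proof (cases x)
    case (real y)
    then show ?thesis
      using \<open>0 \<le> d\<close> \<open>D = ennreal d\<close> by (simp add: esqrt_def ennreal_power real_sqrt_le_iff')
  qed (use real in \<open>simp add: esqrt_def ennreal_power top_unique\<close>)
qed (simp add: power2_eq_square)

lemma esqrt_less_top_iff: "esqrt x < top \<longleftrightarrow> x < top"
  by (cases x) (auto simp: esqrt_def)

section \<open>Analytic characterisation of distribution functions\<close>

text \<open>These properties characterise CDFs of laws on the real line. Stated for functions, they
  can be checked for shifted, rescaled and averaged CDFs without constructing the corresponding
  measures.\<close>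

definition is_cdf :: "(real \<Rightarrow> real) \<Rightarrow> bool" where
  "is_cdf f \<longleftrightarrow> mono f \<and> (\<forall>a. continuous (at_right a) f) \<and> (f \<longlongrightarrow> 0) at_bot \<and> (f \<longlongrightarrow> 1) at_top"

lemma is_cdf_cdf: "real_distribution D \<Longrightarrow> is_cdf (cdf D)"
proof -
  assume "real_distribution D"
  then interpret real_distribution D .
  show ?thesis
    by (auto simp: is_cdf_def cdf_is_right_cont cdf_lim_at_bot cdf_lim_at_top_prob cdf_nondecreasing intro!: monoI)
qed

lemma is_cdf_mono: "is_cdf f \<Longrightarrow> x \<le> y \<Longrightarrow> f x \<le> f y"
  by (auto simp: is_cdf_def dest: monoD)

lemma is_cdf_nonneg: "is_cdf f \<Longrightarrow> 0 \<le> f x"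
  by (rule tendsto_upperbound[of f 0 at_bot])
    (auto simp: is_cdf_def eventually_at_bot_linorder dest: monoD intro!: exI[of _ x])

lemma is_cdf_le_1: "is_cdf f \<Longrightarrow> f x \<le> 1"
  by (rule tendsto_lowerbound[of f 1 at_top])
    (auto simp: is_cdf_def eventually_at_top_linorder dest: monoD intro!: exI[of _ x])

lemma is_cdf_measurable: "is_cdf f \<Longrightarrow> f \<in> borel_measurable borel"
  by (auto simp: is_cdf_def intro: borel_measurable_mono)

lemma is_cdf_right_cont: "is_cdf f \<Longrightarrow> (f \<longlongrightarrow> f a) (at_right a)"
  by (simp add: is_cdf_def continuous_within)

lemma is_cdf_at_bot: "is_cdf f \<Longrightarrow> (f \<longlongrightarrow> 0) at_bot"
  and is_cdf_at_top: "is_cdf f \<Longrightarrow> (f \<longlongrightarrow> 1) at_top"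
  by (simp_all add: is_cdf_def)

lemma cdf_return_0: "cdf (return borel 0) = indicator {0..}"
  by (auto simp: cdf_def fun_eq_iff measure_return indicator_def)

text \<open>For the direction from right to left the law is recovered as the Lebesgue-Stieltjes
  measure \<open>interval_measure f\<close>, whose CDF is \<open>f\<close>.\<close>

lemma Gamma_F_iff: "f \<in> Gamma_F \<longleftrightarrow> is_cdf f \<and> sq_dist f (indicator {0..}) < \<infinity>"
proof
  assume "f \<in> Gamma_F"
  then show "is_cdf f \<and> sq_dist f (indicator {0..}) < \<infinity>"
    by (auto simp: Gamma_F_def cramer_dist_def cdf_return_0 esqrt_less_top_iff is_cdf_cdf)
next
  assume f: "is_cdf f \<and> sq_dist f (indicator {0..}) < \<infinity>"
  then have "cdf (interval_measure f) = f" "real_distribution (interval_measure f)"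
    by (auto simp: is_cdf_def dest: monoD intro!: cdf_interval_measure real_distribution_interval_measure)
  with f show "f \<in> Gamma_F"
    by (auto simp: Gamma_F_def cramer_dist_def cdf_return_0 esqrt_less_top_iff intro!: exI[of _ "interval_measure f"])
qed

text \<open>By right continuity \<open>F y x\<close> is the limit of its values at grid points
  decreasing in mesh to \<open>x\<close> from the right. For each mesh only countably many grid
  points occur, so measurability in \<open>y\<close> at fixed points suffices.\<close>

lemma measurable_cdf_field:
  assumes meas: "\<And>x. (\<lambda>y. F y x) \<in> borel_measurable M"
    and cdf: "\<And>y. y \<in> space M \<Longrightarrow> is_cdf (F y)"
  shows "(\<lambda>(y, x). F y x) \<in> borel_measurable (M \<Otimes>\<^sub>M borel)"
proof (rule borel_measurable_LIMSEQ_real)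
  \<comment> \<open>The \<open>+ 1\<close> puts the grid point \<open>?s n x\<close> strictly to the
    right of \<open>x\<close>, at distance at most the mesh 1/(n+1); strictness is what convergence
    along \<open>at_right\<close> demands.\<close>
  let ?q = "\<lambda>n i. (real_of_int i + 1) / real (Suc n)"
  let ?s = "\<lambda>n x. ?q n \<lfloor>x * real (Suc n)\<rfloor>"
  show "(\<lambda>z. F (fst z) (?s n (snd z))) \<in> borel_measurable (M \<Otimes>\<^sub>M borel)" for n
  proof (rule measurable_compose_countable[where f="\<lambda>i z. F (fst z) (?q n i)"])
    show "(\<lambda>z. F (fst z) (?q n i)) \<in> borel_measurable (M \<Otimes>\<^sub>M borel)" for i
      by (rule measurable_compose[OF measurable_fst meas])
    show "(\<lambda>z. \<lfloor>snd z * real (Suc n)\<rfloor>) \<in> M \<Otimes>\<^sub>M borel \<rightarrow>\<^sub>M count_space UNIV"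
      by measurable
  qed
  fix z :: "'a \<times> real" assume "z \<in> space (M \<Otimes>\<^sub>M borel)"
  then have z: "is_cdf (F (fst z))"
    by (intro cdf) (auto simp: space_pair_measure)
  have gt: "snd z < ?s n (snd z)" and le: "?s n (snd z) \<le> snd z + inverse (real (Suc n))" for n
  proof -
    have "snd z * real (Suc n) < real_of_int \<lfloor>snd z * real (Suc n)\<rfloor> + 1"
      "real_of_int \<lfloor>snd z * real (Suc n)\<rfloor> \<le> snd z * real (Suc n)"
      by linarith+
    then show "snd z < ?s n (snd z)" "?s n (snd z) \<le> snd z + inverse (real (Suc n))"
      by (simp_all add: field_simps del: of_nat_Suc)
  qed
  have "(\<lambda>n. ?s n (snd z)) \<longlonglongrightarrow> snd z"
  proof (rule tendsto_sandwich[where f="\<lambda>_. snd z" and h="\<lambda>n. snd z + inverse (real (Suc n))"])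
    show "(\<lambda>n. snd z + inverse (real (Suc n))) \<longlonglongrightarrow> snd z"
      using tendsto_add[OF tendsto_const LIMSEQ_inverse_real_of_nat, of "snd z"] by simp
    show "\<forall>\<^sub>F n in sequentially. snd z \<le> ?s n (snd z)"
      using gt by (intro always_eventually allI less_imp_le)
    show "\<forall>\<^sub>F n in sequentially. ?s n (snd z) \<le> snd z + inverse (real (Suc n))"
      using le by (intro always_eventually allI)
  qed simp
  then have "filterlim (\<lambda>n. ?s n (snd z)) (at_right (snd z)) sequentially"
    unfolding filterlim_at using less_imp_neq[OF gt, symmetric] gt
    by (intro conjI always_eventually allI) (simp_all only: greaterThan_iff not_False_eq_True)
  from filterlim_compose[OF is_cdf_right_cont[OF z] this]
  show "(\<lambda>n. F (fst z) (?s n (snd z))) \<longlonglongrightarrow> (\<lambda>(y, x). F y x) z"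
    by (simp add: case_prod_beta)
qed

text \<open>If \<open>f\<close> is the CDF of Z, this is the CDF of c + \<gamma> Z. Positivity of
  \<gamma> keeps the order and the sides from which limits are taken.\<close>

lemma is_cdf_affine:
  assumes f: "is_cdf f" and "0 < \<gamma>"
  shows "is_cdf (\<lambda>x. f ((x - c) / \<gamma>))"
  unfolding is_cdf_def
proof (intro conjI allI)
  show "mono (\<lambda>x. f ((x - c) / \<gamma>))"
    using \<open>0 < \<gamma>\<close> by (intro monoI is_cdf_mono[OF f] divide_right_mono) auto
  have "filterlim (\<lambda>x. (x - c) / \<gamma>) at_bot at_bot"
    using \<open>0 < \<gamma>\<close> by real_asymp
  with f show "((\<lambda>x. f ((x - c) / \<gamma>)) \<longlongrightarrow> 0) at_bot"
    by (auto simp: is_cdf_def intro: filterlim_compose)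
  have "filterlim (\<lambda>x. (x - c) / \<gamma>) at_top at_top"
    using \<open>0 < \<gamma>\<close> by real_asymp
  with f show "((\<lambda>x. f ((x - c) / \<gamma>)) \<longlongrightarrow> 1) at_top"
    by (auto simp: is_cdf_def intro: filterlim_compose)
  fix a
  have "filterlim (\<lambda>x. (x - c) / \<gamma>) (at_right ((a - c) / \<gamma>)) (at_right a)"
    unfolding filterlim_at
    using \<open>0 < \<gamma>\<close>
    by (auto simp: eventually_at_filter divide_strict_right_mono intro!: tendsto_intros always_eventually)
  from filterlim_compose[OF is_cdf_right_cont[OF f] this]
  show "continuous (at_right a) (\<lambda>x. f ((x - c) / \<gamma>))"
    by (simp add: continuous_within)
qed

text \<open>All limits pass through the integral by dominated convergence along sequences, with the
  constant 1 as dominating function; the average is the CDF of the mixture.\<close>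

lemma (in prob_space) is_cdf_integral:
  assumes meas: "\<And>x. (\<lambda>y. F y x) \<in> borel_measurable M"
    and cdf: "\<And>y. y \<in> space M \<Longrightarrow> is_cdf (F y)"
  shows "is_cdf (\<lambda>x. \<integral>y. F y x \<partial>M)"
proof -
  have bound: "norm (F y x) \<le> 1" if "y \<in> space M" for x y
    using is_cdf_nonneg[OF cdf[OF that], of x] is_cdf_le_1[OF cdf[OF that], of x] by simp
  have int: "integrable M (\<lambda>y. F y x)" for x
    by (rule integrable_const_bound[of _ 1]) (use meas bound in auto)
  have lim: "(\<lambda>n. \<integral>y. F y (X n) \<partial>M) \<longlonglongrightarrow> (\<integral>y. L y \<partial>M)"
    if "L \<in> borel_measurable M" "\<And>y. y \<in> space M \<Longrightarrow> (\<lambda>n. F y (X n)) \<longlonglongrightarrow> L y" for X :: "nat \<Rightarrow> real" and L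
    by (rule integral_dominated_convergence[where w="\<lambda>_. 1"]) (use that meas bound in auto)
  show ?thesis
    unfolding is_cdf_def
  proof (intro conjI allI)
    show "mono (\<lambda>x. \<integral>y. F y x \<partial>M)"
      by (intro monoI integral_mono int is_cdf_mono[OF cdf])
    show "((\<lambda>x. \<integral>y. F y x \<partial>M) \<longlongrightarrow> 1) at_top"
    proof (rule tendsto_at_topI_sequentially)
      fix X :: "nat \<Rightarrow> real" assume "filterlim X at_top sequentially"
      then have "(\<lambda>n. F y (X n)) \<longlonglongrightarrow> 1" if "y \<in> space M" for y
        by (rule filterlim_compose[OF is_cdf_at_top[OF cdf[OF that]]])
      from lim[of "\<lambda>_. 1", OF _ this] show "(\<lambda>n. \<integral>y. F y (X n) \<partial>M) \<longlonglongrightarrow> 1"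
        by (simp add: prob_space)
    qed
    \<comment> \<open>Reflection moves the limit to \<open>at_top\<close>, where the sequential
      criterion applies.\<close>
    have "((\<lambda>x. \<integral>y. F y (- x) \<partial>M) \<longlongrightarrow> 0) at_top"
    proof (rule tendsto_at_topI_sequentially)
      fix X :: "nat \<Rightarrow> real" assume "filterlim X at_top sequentially"
      then have "filterlim (\<lambda>n. - X n) at_bot sequentially"
        by (simp add: filterlim_uminus_at_bot)
      then have "(\<lambda>n. F y (- X n)) \<longlonglongrightarrow> 0" if "y \<in> space M" for y
        by (rule filterlim_compose[OF is_cdf_at_bot[OF cdf[OF that]]])
      from lim[of "\<lambda>_. 0", OF _ this] show "(\<lambda>n. \<integral>y. F y (- X n) \<partial>M) \<longlonglongrightarrow> 0"
        by simp
    qed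
    then show "((\<lambda>x. \<integral>y. F y x \<partial>M) \<longlongrightarrow> 0) at_bot"
      by (simp add: filterlim_at_bot_mirror)
    fix a :: real
    show "continuous (at_right a) (\<lambda>x. \<integral>y. F y x \<partial>M)"
      unfolding continuous_within
    proof (rule tendsto_at_right_sequentially[of a "a + 1"])
      fix X :: "nat \<Rightarrow> real" assume "\<And>n. a < X n" "X \<longlonglongrightarrow> a"
      then have "filterlim X (at_right a) sequentially"
        by (auto simp: filterlim_at intro!: always_eventually)
      then show "(\<lambda>n. \<integral>y. F y (X n) \<partial>M) \<longlonglongrightarrow> (\<integral>y. F y a \<partial>M)"
        by (intro lim meas filterlim_compose[OF is_cdf_right_cont[OF cdf]])
    qed simp
  qed
qed

section \<open>Jensen's inequality and estimates for the squared distance\<close>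

text \<open>Jensen's inequality for the square, obtained from nonnegativity of the variance; the
  bound on \<open>w\<close> makes both \<open>w\<close> and its square integrable.\<close>

lemma (in prob_space) square_integral_le:
  fixes w :: "'a \<Rightarrow> real"
  assumes w [measurable]: "w \<in> borel_measurable M" and bound: "\<And>y. y \<in> space M \<Longrightarrow> \<bar>w y\<bar> \<le> 1"
  shows "ennreal ((\<integral>y. w y \<partial>M)\<^sup>2) \<le> (\<integral>\<^sup>+y. ennreal ((w y)\<^sup>2) \<partial>M)"
proof -
  have int: "integrable M w"
    by (rule integrable_const_bound[of _ 1]) (auto intro: bound)
  have int2: "integrable M (\<lambda>y. (w y)\<^sup>2)"
    by (rule integrable_const_bound[of _ 1]) (auto simp: abs_square_le_1 intro: bound)
  have "(\<integral>y. w y \<partial>M)\<^sup>2 \<le> (\<integral>y. (w y)\<^sup>2 \<partial>M)"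
    using variance_positive[of w] variance_eq[OF int int2] by simp
  then show ?thesis
    by (simp add: nn_integral_eq_integral[OF int2] ennreal_leI)
qed

text \<open>Jensen's inequality at each \<open>x\<close>, then Tonelli to exchange the two
  integrals; the exchange is what joint measurability is for.\<close>

lemma (in prob_space) sq_dist_integral_le:
  assumes u: "(\<lambda>(y, x). u y x) \<in> borel_measurable (M \<Otimes>\<^sub>M borel)"
    and v: "(\<lambda>(y, x). v y x) \<in> borel_measurable (M \<Otimes>\<^sub>M borel)"
    and "\<And>y x. y \<in> space M \<Longrightarrow> u y x \<in> {0..1}" "\<And>y x. y \<in> space M \<Longrightarrow> v y x \<in> {0..1}"
  shows "sq_dist (\<lambda>x. \<integral>y. u y x \<partial>M) (\<lambda>x. \<integral>y. v y x \<partial>M) \<le> (\<integral>\<^sup>+y. sq_dist (u y) (v y) \<partial>M)"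
proof -
  interpret pair_sigma_finite M lborel ..
  have u' [measurable]: "(\<lambda>(y, x). u y x) \<in> borel_measurable (M \<Otimes>\<^sub>M lborel)"
    and v' [measurable]: "(\<lambda>(y, x). v y x) \<in> borel_measurable (M \<Otimes>\<^sub>M lborel)"
    using u v by (simp_all add: measurable_cong_sets[OF sets_pair_measure_cong[OF refl sets_lborel] refl])
  have [measurable]: "(\<lambda>y. u y x) \<in> borel_measurable M" "(\<lambda>y. v y x) \<in> borel_measurable M" for x
    using measurable_compose[OF measurable_Pair2' u, of x] measurable_compose[OF measurable_Pair2' v, of x] by simp_all
  have int: "integrable M (\<lambda>y. u y x)" "integrable M (\<lambda>y. v y x)" for x
    using assms(3,4) by (auto intro!: integrable_const_bound[of _ 1])
  have "sq_dist (\<lambda>x. \<integral>y. u y x \<partial>M) (\<lambda>x. \<integral>y. v y x \<partial>M) \<le> (\<integral>\<^sup>+x. \<integral>\<^sup>+y. ennreal ((u y x - v y x)\<^sup>2) \<partial>M \<partial>lborel)"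
    unfolding sq_dist_def
  proof (intro nn_integral_mono)
    fix x
    have "\<bar>u y x - v y x\<bar> \<le> 1" if "y \<in> space M" for y
      using assms(3,4)[OF that, of x] by auto
    from square_integral_le[of "\<lambda>y. u y x - v y x", OF _ this]
    show "ennreal (((\<integral>y. u y x \<partial>M) - (\<integral>y. v y x \<partial>M))\<^sup>2) \<le> (\<integral>\<^sup>+y. ennreal ((u y x - v y x)\<^sup>2) \<partial>M)"
      by (simp add: int)
  qed
  also have "\<dots> = (\<integral>\<^sup>+y. \<integral>\<^sup>+x. ennreal ((u y x - v y x)\<^sup>2) \<partial>lborel \<partial>M)"
    by (rule Fubini') measurable
  finally show ?thesis
    by (simp add: sq_dist_def)
qed

lemma sq_dist_commute: "sq_dist f g = sq_dist g f"
  by (simp add: sq_dist_def power2_commute)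

text \<open>Substitution x = c + \<gamma> u. Its Jacobian \<gamma> is the source of the contraction
  factor.\<close>

lemma sq_dist_affine:
  assumes [measurable]: "f \<in> borel_measurable borel" "g \<in> borel_measurable borel" and "0 < \<gamma>"
  shows "sq_dist (\<lambda>x. f ((x - c) / \<gamma>)) (\<lambda>x. g ((x - c) / \<gamma>)) = ennreal \<gamma> * sq_dist f g"
  unfolding sq_dist_def using \<open>0 < \<gamma>\<close> by (subst nn_integral_real_affine[where c=\<gamma> and t=c]) auto

text \<open>A substitute for the triangle inequality that stays with squares. The factors 2 do no
  harm because it only serves to prove finiteness.\<close>

lemma sq_dist_triangle:
  assumes [measurable]: "f \<in> borel_measurable borel" "g \<in> borel_measurable borel" "h \<in> borel_measurable borel"
  shows "sq_dist f h \<le> 2 * sq_dist f g + 2 * sq_dist g h"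
proof -
  have "(f x - h x)\<^sup>2 \<le> 2 * (f x - g x)\<^sup>2 + 2 * (g x - h x)\<^sup>2" for x
    \<comment> \<open>The difference of the two sides is the square of (f - g) - (g - h).\<close>
    using zero_le_power2[of "(f x - g x) - (g x - h x)"] by (simp add: power2_eq_square algebra_simps)
  then have "ennreal ((f x - h x)\<^sup>2) \<le> 2 * ennreal ((f x - g x)\<^sup>2) + 2 * ennreal ((g x - h x)\<^sup>2)" for x
    by (simp add: ennreal_plus[symmetric] ennreal_mult'[symmetric] ennreal_numeral[symmetric] ennreal_leI
        del: ennreal_plus ennreal_numeral)
  then have "sq_dist f h \<le> (\<integral>\<^sup>+x. 2 * ennreal ((f x - g x)\<^sup>2) + 2 * ennreal ((g x - h x)\<^sup>2) \<partial>lborel)"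
    unfolding sq_dist_def by (intro nn_integral_mono)
  also have "\<dots> = 2 * sq_dist f g + 2 * sq_dist g h"
    by (simp add: sq_dist_def nn_integral_add nn_integral_cmult)
  finally show ?thesis .
qed

text \<open>The first function is the CDF of the point mass at \<open>c\<close>; the two unit steps
  differ by exactly 1 between 0 and \<open>c\<close> and agree elsewhere.\<close>

lemma sq_dist_step:
  assumes "0 < \<gamma>"
  shows "sq_dist (\<lambda>x. indicator {0..} ((x - c) / \<gamma>)) (indicator {0..}) = ennreal \<bar>c\<bar>"
proof -
  have "sq_dist (\<lambda>x. indicator {0..} ((x - c) / \<gamma>)) (indicator {0..}) = (\<integral>\<^sup>+x. indicator {min 0 c..<max 0 c} x \<partial>lborel)"
    unfolding sq_dist_def using assms
    by (intro nn_integral_cong) (auto simp: indicator_def zero_le_divide_iff)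
  also have "\<dots> = ennreal \<bar>c\<bar>"
    by (simp add: min_def max_def)
  finally show ?thesis .
qed

text \<open>By right continuity, a difference at one point persists on an open interval to its
  right, which has positive Lebesgue measure.\<close>

lemma is_cdf_eqI:
  assumes f: "is_cdf f" and g: "is_cdf g" and "sq_dist f g = 0"
  shows "f = g"
proof (rule ext, rule ccontr)
  fix a assume "f a \<noteq> g a"
  note [measurable] = is_cdf_measurable[OF f] is_cdf_measurable[OF g]
  have "((\<lambda>x. f x - g x) \<longlongrightarrow> f a - g a) (at_right a)"
    by (intro tendsto_diff is_cdf_right_cont f g)
  then have "\<forall>\<^sub>F x in at_right a. f x - g x \<noteq> 0"
    using \<open>f a \<noteq> g a\<close> by (intro tendsto_imp_eventually_ne) auto
  then obtain b where "a < b" and b: "\<And>x. a < x \<Longrightarrow> x < b \<Longrightarrow> f x \<noteq> g x"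
    by (auto simp: eventually_at_right_field)
  have "AE x in lborel. ennreal ((f x - g x)\<^sup>2) = 0"
    using \<open>sq_dist f g = 0\<close> unfolding sq_dist_def by (subst (asm) nn_integral_0_iff_AE) auto
  then have "AE x in lborel. x \<notin> {a<..<b}"
    by eventually_elim (use b in auto)
  then have "emeasure lborel {a<..<b} = 0"
    by (subst (asm) AE_iff_measurable[of "{a<..<b}"]) auto
  then show False
    using \<open>a < b\<close> by simp
qed

section \<open>Affine mixtures of distribution functions\<close>

text \<open>The average is the CDF of c(y) + \<gamma> Z, where y is drawn from \<open>M\<close> and
  Z then has CDF \<open>F y\<close>. The last bound separates the spread of Z from the size of the
  shift.\<close>

lemma (in prob_space)
  assumes meas: "\<And>t. (\<lambda>y. F y t) \<in> borel_measurable M"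
    and cdf: "\<And>y. y \<in> space M \<Longrightarrow> is_cdf (F y)"
    and c [measurable]: "c \<in> borel_measurable M" and "0 < \<gamma>"
  shows measurable_affine_mixture:
      "(\<lambda>(y, t). F y ((t - c y) / \<gamma>)) \<in> borel_measurable (M \<Otimes>\<^sub>M borel)"
    and is_cdf_affine_mixture: "is_cdf (\<lambda>t. \<integral>y. F y ((t - c y) / \<gamma>) \<partial>M)"
    and sq_dist_affine_mixture_step: "sq_dist (\<lambda>t. \<integral>y. F y ((t - c y) / \<gamma>) \<partial>M) (indicator {0..})
      \<le> (\<integral>\<^sup>+y. 2 * (ennreal \<gamma> * sq_dist (F y) (indicator {0..})) + 2 * ennreal \<bar>c y\<bar> \<partial>M)"
proof -
  have [measurable]: "(\<lambda>(y, t). F y t) \<in> borel_measurable (M \<Otimes>\<^sub>M borel)"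
    using meas cdf by (rule measurable_cdf_field)
  show joint: "(\<lambda>(y, t). F y ((t - c y) / \<gamma>)) \<in> borel_measurable (M \<Otimes>\<^sub>M borel)"
    by measurable
  have affine: "is_cdf (\<lambda>t. F y ((t - c y) / \<gamma>))" if "y \<in> space M" for y
    using cdf[OF that] \<open>0 < \<gamma>\<close> by (rule is_cdf_affine)
  show "is_cdf (\<lambda>t. \<integral>y. F y ((t - c y) / \<gamma>) \<partial>M)"
    by (rule is_cdf_integral[OF _ affine]) measurable
  \<comment> \<open>The unit step is written as an average of a constant family, so that both
    arguments are mixtures over \<open>M\<close>.\<close>
  have "sq_dist (\<lambda>t. \<integral>y. F y ((t - c y) / \<gamma>) \<partial>M) (\<lambda>t. \<integral>y. indicator {0..} t \<partial>M)
      \<le> (\<integral>\<^sup>+y. sq_dist (\<lambda>t. F y ((t - c y) / \<gamma>)) (indicator {0..}) \<partial>M)"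
    using is_cdf_nonneg[OF affine] is_cdf_le_1[OF affine]
    by (intro sq_dist_integral_le joint) (auto simp: indicator_def)
  also have "\<dots> \<le> (\<integral>\<^sup>+y. 2 * (ennreal \<gamma> * sq_dist (F y) (indicator {0..})) + 2 * ennreal \<bar>c y\<bar> \<partial>M)"
  proof (intro nn_integral_mono)
    fix y assume y: "y \<in> space M"
    note [measurable] = is_cdf_measurable[OF cdf[OF y]]
    \<comment> \<open>The intermediate function is the CDF of the point mass at \<open>c y\<close>:
      the first distance scales by \<gamma>, the second equals \<bar>c y\<bar>.\<close>
    have "sq_dist (\<lambda>t. F y ((t - c y) / \<gamma>)) (indicator {0..}) \<le>
      2 * sq_dist (\<lambda>t. F y ((t - c y) / \<gamma>)) (\<lambda>t. indicator {0..} ((t - c y) / \<gamma>)) +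
      2 * sq_dist (\<lambda>t. indicator {0..} ((t - c y) / \<gamma>)) (indicator {0..})"
      by (rule sq_dist_triangle) measurable
    then show "sq_dist (\<lambda>t. F y ((t - c y) / \<gamma>)) (indicator {0..}) \<le>
      2 * (ennreal \<gamma> * sq_dist (F y) (indicator {0..})) + 2 * ennreal \<bar>c y\<bar>"
      using \<open>0 < \<gamma>\<close> by (simp add: sq_dist_affine sq_dist_step)
  qed
  finally show "sq_dist (\<lambda>t. \<integral>y. F y ((t - c y) / \<gamma>) \<partial>M) (indicator {0..})
      \<le> (\<integral>\<^sup>+y. 2 * (ennreal \<gamma> * sq_dist (F y) (indicator {0..})) + 2 * ennreal \<bar>c y\<bar> \<partial>M)"
    by (simp add: prob_space)
qed

text \<open>Both mixtures use the same shift \<open>c y\<close>, so the shift cancels for each y and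
  only the scaling by \<gamma> is left.\<close>

lemma (in prob_space) sq_dist_affine_mixture:
  assumes F: "\<And>t. (\<lambda>y. F y t) \<in> borel_measurable M" "\<And>y. y \<in> space M \<Longrightarrow> is_cdf (F y)"
    and G: "\<And>t. (\<lambda>y. G y t) \<in> borel_measurable M" "\<And>y. y \<in> space M \<Longrightarrow> is_cdf (G y)"
    and c: "c \<in> borel_measurable M" and \<gamma>: "0 < \<gamma>"
  shows "sq_dist (\<lambda>t. \<integral>y. F y ((t - c y) / \<gamma>) \<partial>M) (\<lambda>t. \<integral>y. G y ((t - c y) / \<gamma>) \<partial>M)
    \<le> (\<integral>\<^sup>+y. ennreal \<gamma> * sq_dist (F y) (G y) \<partial>M)"
proof -
  have "sq_dist (\<lambda>t. \<integral>y. F y ((t - c y) / \<gamma>) \<partial>M) (\<lambda>t. \<integral>y. G y ((t - c y) / \<gamma>) \<partial>M)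
      \<le> (\<integral>\<^sup>+y. sq_dist (\<lambda>t. F y ((t - c y) / \<gamma>)) (\<lambda>t. G y ((t - c y) / \<gamma>)) \<partial>M)"
    using is_cdf_nonneg[OF F(2)] is_cdf_le_1[OF F(2)] is_cdf_nonneg[OF G(2)] is_cdf_le_1[OF G(2)]
    by (intro sq_dist_integral_le measurable_affine_mixture F G c \<gamma>) auto
  also have "\<dots> = (\<integral>\<^sup>+y. ennreal \<gamma> * sq_dist (F y) (G y) \<partial>M)"
    by (intro nn_integral_cong sq_dist_affine is_cdf_measurable F G \<gamma>)
  finally show ?thesis .
qed

section \<open>CDF fields\<close>

lemma X_cdf_iff:
  "F \<in> X_cdf S A \<longleftrightarrow> F \<in> extensional (space (S \<Otimes>\<^sub>M A)) \<and> (\<forall>x\<in>space (S \<Otimes>\<^sub>M A). is_cdf (F x)) \<and>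
     (\<forall>t. (\<lambda>x. F x t) \<in> borel_measurable (S \<Otimes>\<^sub>M A)) \<and>
     (\<exists>B<top. \<forall>x\<in>space (S \<Otimes>\<^sub>M A). sq_dist (F x) (indicator {0..}) \<le> B)"
proof -
  have "(SUP x\<in>space (S \<Otimes>\<^sub>M A). sq_dist (F x) (indicator {0..})) < \<infinity> \<longleftrightarrow>
    (\<exists>B<top. \<forall>x\<in>space (S \<Otimes>\<^sub>M A). sq_dist (F x) (indicator {0..}) \<le> B)"
    by (auto simp: SUP_le_iff[symmetric] intro: le_less_trans)
  then show ?thesis
    by (auto simp: X_cdf_def Gamma_F_iff PiE_iff intro: le_less_trans)
qed

lemma d_Cr_le_iff: "d_Cr S A F G \<le> D \<longleftrightarrow> (\<forall>x\<in>space (S \<Otimes>\<^sub>M A). sq_dist (F x) (G x) \<le> D\<^sup>2)"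
  by (simp add: d_Cr_def SUP_le_iff esqrt_le_iff)

text \<open>Both fields are compared with the unit step at 0, from which each has uniformly bounded
  squared distance.\<close>

lemma d_Cr_finite:
  assumes F: "F \<in> X_cdf S A" and G: "G \<in> X_cdf S A"
  shows "d_Cr S A F G < top"
proof -
  obtain B where B: "B < top" "\<And>x. x \<in> space (S \<Otimes>\<^sub>M A) \<Longrightarrow> sq_dist (F x) (indicator {0..}) \<le> B"
    using F by (auto simp: X_cdf_iff)
  obtain C where C: "C < top" "\<And>x. x \<in> space (S \<Otimes>\<^sub>M A) \<Longrightarrow> sq_dist (G x) (indicator {0..}) \<le> C"
    using G by (auto simp: X_cdf_iff)
  have "d_Cr S A F G \<le> esqrt (2 * B + 2 * C)"
    unfolding d_Cr_le_iff
  proof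
    fix x assume x: "x \<in> space (S \<Otimes>\<^sub>M A)"
    have "sq_dist (F x) (G x) \<le> 2 * sq_dist (F x) (indicator {0..}) + 2 * sq_dist (indicator {0..}) (G x)"
      using F G x by (intro sq_dist_triangle) (auto simp: X_cdf_iff is_cdf_measurable)
    also have "\<dots> \<le> 2 * B + 2 * C"
      using B(2) C(2) x by (intro add_mono mult_left_mono) (auto simp: sq_dist_commute[of "indicator {0..}"])
    also have "\<dots> \<le> (esqrt (2 * B + 2 * C))\<^sup>2"
      by (simp add: esqrt_le_iff[symmetric])
    finally show "sq_dist (F x) (G x) \<le> (esqrt (2 * B + 2 * C))\<^sup>2" .
  qed
  also have "\<dots> < top"
    using B(1) C(1) by (simp add: esqrt_less_top_iff ennreal_mult_less_top)
  finally show ?thesis .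
qed

lemma d_Cr_eq_0_imp_eq:
  assumes F: "F \<in> X_cdf S A" and G: "G \<in> X_cdf S A" and 0: "d_Cr S A F G = 0"
  shows "F = G"
proof (rule extensionalityI)
  show "F \<in> extensional (space (S \<Otimes>\<^sub>M A))" "G \<in> extensional (space (S \<Otimes>\<^sub>M A))"
    using F G by (auto simp: X_cdf_iff)
  fix x assume x: "x \<in> space (S \<Otimes>\<^sub>M A)"
  have "sq_dist (F x) (G x) = 0"
    using d_Cr_le_iff[of S A F G 0] 0 x by simp
  then show "F x = G x"
    using F G x by (intro is_cdf_eqI) (auto simp: X_cdf_iff)
qed

section \<open>The law of a Markov chain\<close>

text \<open>State-action pairs form a Markov chain, and the law of the trajectory depends on the
  kernel alone; it is therefore studied for an abstract state space.\<close>

locale markov_kernel =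
  fixes M :: "'x measure" and K :: "'x \<Rightarrow> 'x measure"
  assumes K [measurable]: "K \<in> M \<rightarrow>\<^sub>M prob_algebra M"
begin

text \<open>This has the shape of \<open>traj_kernel\<close>, so that \<open>chain_law\<close>
  becomes \<open>trajectory_law\<close> once \<open>K\<close> is \<open>next_law\<close>.\<close>

definition step :: "'x \<Rightarrow> nat \<Rightarrow> (nat \<Rightarrow> 'x) \<Rightarrow> 'x measure" where
  "step x n \<omega> = (case n of 0 \<Rightarrow> return M x | Suc m \<Rightarrow> K (\<omega> m))"

definition chain_law :: "'x \<Rightarrow> (nat \<Rightarrow> 'x) measure" where
  "chain_law x = projective_family.lim UNIV (Ionescu_Tulcea.CI (step x) (\<lambda>_. M)) (\<lambda>_. M)"

lemma K_subprob [measurable]: "K \<in> M \<rightarrow>\<^sub>M subprob_algebra M"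
  by (rule measurable_prob_algebraD) (rule K)

lemma
  assumes "x \<in> space M"
  shows prob_space_K: "prob_space (K x)" and sets_K: "sets (K x) = sets M"
    and space_K: "space (K x) = space M"
proof -
  have "K x \<in> space (prob_algebra M)"
    using K assms by (rule measurable_space)
  then show "prob_space (K x)" and *: "sets (K x) = sets M"
    by (auto simp: space_prob_algebra)
  from * show "space (K x) = space M"
    by (rule sets_eq_imp_space_eq)
qed

section \<open>The Ionescu-Tulcea measure and its finite marginals\<close>

lemma Ionescu_Tulcea_step:
  assumes x: "x \<in> space M"
  shows "Ionescu_Tulcea (step x) (\<lambda>_. M)"
proof (rule Ionescu_Tulcea.intro)
  show "step x i \<in> PiM {0..<i} (\<lambda>_. M) \<rightarrow>\<^sub>M subprob_algebra M" for i
  proof (cases i)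
    case 0
    then show ?thesis
      using x measurable_space[OF return_measurable x] by (simp add: step_def[abs_def])
  next
    case (Suc m)
    have "(\<lambda>\<omega>. \<omega> m) \<in> PiM {0..<Suc m} (\<lambda>_. M) \<rightarrow>\<^sub>M M"
      by (rule measurable_component_singleton) simp
    from measurable_compose[OF this K_subprob] show ?thesis
      by (simp add: step_def[abs_def] Suc)
  qed
  show "prob_space (step x i \<omega>)" if "\<omega> \<in> space (PiM {0..<i} (\<lambda>_. M))" for i \<omega>
  proof (cases i)
    case 0
    then show ?thesis
      using x by (simp add: step_def prob_space_return)
  next
    case (Suc m)
    then have "\<omega> m \<in> space M"
      using that by (auto simp: space_PiM PiE_iff)
    then show ?thesis
      by (simp add: step_def Suc prob_space_K)
  qed
qed

text \<open>The last fact integrates out the most recent coordinate by its kernel. It is read off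
  the marginals on initial segments, which the construction builds one draw at a time.\<close>

lemma
  assumes x: "x \<in> space M"
  shows prob_space_chain_law: "prob_space (chain_law x)"
    and sets_chain_law: "sets (chain_law x) = sets (PiM UNIV (\<lambda>_. M))"
    and space_chain_law: "space (chain_law x) = space (PiM UNIV (\<lambda>_. M))"
    and nn_integral_chain_law_Suc: "\<And>n f. f \<in> borel_measurable (PiM {0..<Suc n} (\<lambda>_. M)) \<Longrightarrow>
      (\<integral>\<^sup>+\<omega>. f (restrict \<omega> {0..<Suc n}) \<partial>chain_law x) =
      (\<integral>\<^sup>+\<omega>. (\<integral>\<^sup>+y. f ((restrict \<omega> {0..<n})(n := y)) \<partial>step x n (restrict \<omega> {0..<n})) \<partial>chain_law x)"
proof -
  interpret IT: Ionescu_Tulcea "step x" "\<lambda>_. M"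
    using x by (rule Ionescu_Tulcea_step)
  show sets: "sets (chain_law x) = sets (PiM UNIV (\<lambda>_. M))"
    unfolding chain_law_def by (rule IT.PF.sets_lim)
  then show space: "space (chain_law x) = space (PiM UNIV (\<lambda>_. M))"
    by (rule sets_eq_imp_space_eq)
  \<comment> \<open>The marginal on an index set is projected from the shortest initial segment
    containing it; for an initial segment the projection is the identity.\<close>
  have up_to: "IT.up_to {0..<n} = n" for n
    using IT.up_to[of "{0..<n}"] IT.up_to_iff_Ico[of "{0..<n}" n] by auto
  have distr: "distr (chain_law x) (PiM {0..<n} (\<lambda>_. M)) (\<lambda>\<omega>. restrict \<omega> {0..<n}) = IT.C 0 n (\<lambda>_. undefined)" for n
  proof -
    have "distr (chain_law x) (PiM {0..<n} (\<lambda>_. M)) (\<lambda>\<omega>. restrict \<omega> {0..<n}) = IT.CI {0..<n}"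
      unfolding chain_law_def by (rule IT.distr_lim) simp
    also have "\<dots> = distr (IT.C 0 n (\<lambda>_. undefined)) (IT.C 0 n (\<lambda>_. undefined)) (\<lambda>\<omega>. \<omega>)"
      unfolding IT.CI_def up_to
      by (rule distr_cong) (auto simp: IT.sets_C IT.space_C space_PiM PiE_iff extensional_restrict)
    finally show ?thesis
      by simp
  qed
  have restr: "(\<lambda>\<omega>. restrict \<omega> {0..<n}) \<in> chain_law x \<rightarrow>\<^sub>M PiM {0..<n} (\<lambda>_. M)" for n
    unfolding measurable_cong_sets[OF sets refl] by (rule measurable_restrict_subset) simp
  have nn: "(\<integral>\<^sup>+\<omega>. f (restrict \<omega> {0..<n}) \<partial>chain_law x) = (\<integral>\<^sup>+\<omega>. f \<omega> \<partial>IT.C 0 n (\<lambda>_. undefined))"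
    if "f \<in> borel_measurable (PiM {0..<n} (\<lambda>_. M))" for f n
  proof -
    have "f \<in> borel_measurable (distr (chain_law x) (PiM {0..<n} (\<lambda>_. M)) (\<lambda>\<omega>. restrict \<omega> {0..<n}))"
      using that by simp
    from nn_integral_distr[OF restr this] show ?thesis
      by (simp only: distr)
  qed
  \<comment> \<open>One image being a probability measure is enough; the projection to no
    coordinates at all is taken.\<close>
  show "prob_space (chain_law x)"
  proof (rule prob_space_distrD[OF restr[of 0]])
    show "prob_space (distr (chain_law x) (PiM {0..<0} (\<lambda>_. M)) (\<lambda>\<omega>. restrict \<omega> {0..<0}))"
      unfolding distr by (rule IT.prob_space_C) simp
  qed
  fix n and f :: "(nat \<Rightarrow> 'x) \<Rightarrow> ennreal" assume f [measurable]: "f \<in> borel_measurable (PiM {0..<Suc n} (\<lambda>_. M))"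
  \<comment> \<open>\<open>IT.eP n\<close> extends a history of length n by one draw, and binding it
    to the law of such histories gives the law for length n + 1.\<close>
  have eP: "IT.eP n \<in> PiM {0..<n} (\<lambda>_. M) \<rightarrow>\<^sub>M subprob_algebra (PiM {0..<Suc n} (\<lambda>_. M))"
    by (rule IT.measurable_eP)
  have C: "IT.eP n \<in> IT.C 0 n (\<lambda>_. undefined) \<rightarrow>\<^sub>M subprob_algebra (PiM {0..<Suc n} (\<lambda>_. M))"
    using eP by (subst measurable_cong_sets[OF IT.sets_C refl]) simp_all
  have "(\<integral>\<^sup>+\<omega>. f (restrict \<omega> {0..<Suc n}) \<partial>chain_law x) = (\<integral>\<^sup>+\<omega>. f \<omega> \<partial>IT.C 0 (Suc n) (\<lambda>_. undefined))"
    by (rule nn) (rule f)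
  also have "\<dots> = (\<integral>\<^sup>+\<omega>. (\<integral>\<^sup>+\<omega>'. f \<omega>' \<partial>IT.eP n \<omega>) \<partial>IT.C 0 n (\<lambda>_. undefined))"
    using nn_integral_bind[OF f C] by simp
  also have "\<dots> = (\<integral>\<^sup>+\<omega>. (\<integral>\<^sup>+\<omega>'. f \<omega>' \<partial>IT.eP n (restrict \<omega> {0..<n})) \<partial>chain_law x)"
    by (rule nn[symmetric]) (rule measurable_compose[OF eP nn_integral_measurable_subprob_algebra[OF f]])
  also have "\<dots> = (\<integral>\<^sup>+\<omega>. (\<integral>\<^sup>+y. f ((restrict \<omega> {0..<n})(n := y)) \<partial>step x n (restrict \<omega> {0..<n})) \<partial>chain_law x)"
    using measurable_space[OF restr[of n]] by (intro nn_integral_cong IT.nn_integral_eP f) auto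
  finally show "(\<integral>\<^sup>+\<omega>. f (restrict \<omega> {0..<Suc n}) \<partial>chain_law x) =
      (\<integral>\<^sup>+\<omega>. (\<integral>\<^sup>+y. f ((restrict \<omega> {0..<n})(n := y)) \<partial>step x n (restrict \<omega> {0..<n})) \<partial>chain_law x)" .
qed

section \<open>Cylinder sets\<close>

text \<open>The expectation of \<open>g\<close> at time \<open>n\<close> on the event that the chain
  started at \<open>x\<close> lies in \<open>B i\<close> at each time i < n, written through the
  kernel alone.\<close>

primrec cyl :: "nat \<Rightarrow> (nat \<Rightarrow> 'x set) \<Rightarrow> ('x \<Rightarrow> ennreal) \<Rightarrow> 'x \<Rightarrow> ennreal" where
  "cyl 0 B g = g"
| "cyl (Suc n) B g = (\<lambda>x. indicator (B 0) x * (\<integral>\<^sup>+y. cyl n (\<lambda>i. B (Suc i)) g y \<partial>K x))"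

text \<open>\<open>cyl\<close> peels off the first step of the chain, the Ionescu-Tulcea construction appends a last one.\<close>

lemma cyl_Suc_last: "cyl (Suc n) B g = cyl n B (\<lambda>x. indicator (B n) x * (\<integral>\<^sup>+y. g y \<partial>K x))"
proof (induction n arbitrary: B)
  case (Suc n)
  show ?case
    using Suc[of "\<lambda>i. B (Suc i)"] by (simp only: cyl.simps(2))
qed simp

lemma measurable_nn_integral_K [measurable]:
  "g \<in> borel_measurable M \<Longrightarrow> (\<lambda>x. \<integral>\<^sup>+y. g y \<partial>K x) \<in> borel_measurable M"
  by (rule measurable_compose[OF K_subprob nn_integral_measurable_subprob_algebra])

lemma measurable_cyl:
  assumes "\<And>i. B i \<in> sets M" "g \<in> borel_measurable M"
  shows "cyl n B g \<in> borel_measurable M"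
  using assms
proof (induction n arbitrary: B)
  case (Suc n)
  have [measurable]: "cyl n (\<lambda>i. B (Suc i)) g \<in> borel_measurable M" "B 0 \<in> sets M"
    using Suc by auto
  show ?case
    by simp
qed simp

text \<open>Integrating out the last coordinate turns the last set and \<open>g\<close> into a new
  function one time step earlier, which is why the induction generalises over
  \<open>g\<close>.\<close>

lemma nn_integral_chain_law_cyl:
  assumes x: "x \<in> space M" and B: "\<And>i. B i \<in> sets M" and "g \<in> borel_measurable M"
  shows "(\<integral>\<^sup>+\<omega>. (\<Prod>i<n. indicator (B i) (\<omega> i)) * g (\<omega> n) \<partial>chain_law x) = cyl n B g x"
  using assms(3)
proof (induction n arbitrary: g)
  case 0
  note [measurable] = 0
  interpret prob_space "chain_law x"
    using x by (rule prob_space_chain_law)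
  have "(\<lambda>\<omega>. g (\<omega> 0)) \<in> borel_measurable (PiM {0..<Suc 0} (\<lambda>_. M))"
    by measurable
  from nn_integral_chain_law_Suc[OF x this] show ?case
    using x 0 by (simp add: step_def nn_integral_return emeasure_space_1)
next
  case (Suc n)
  note [measurable] = Suc.prems B
  have "(\<lambda>\<omega>. (\<Prod>i<Suc n. indicator (B i) (\<omega> i)) * g (\<omega> (Suc n))) \<in> borel_measurable (PiM {0..<Suc (Suc n)} (\<lambda>_. M))"
    by (intro borel_measurable_times_ennreal borel_measurable_prod_ennreal
        measurable_compose[OF measurable_component_singleton] borel_measurable_indicator) auto
  from nn_integral_chain_law_Suc[OF x this]
  have "(\<integral>\<^sup>+\<omega>. (\<Prod>i<Suc n. indicator (B i) (\<omega> i)) * g (\<omega> (Suc n)) \<partial>chain_law x) =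
    (\<integral>\<^sup>+\<omega>. (\<integral>\<^sup>+y. (\<Prod>i<Suc n. indicator (B i) (\<omega> i)) * g y \<partial>K (\<omega> n)) \<partial>chain_law x)"
    by (simp add: step_def)
  also have "\<dots> = (\<integral>\<^sup>+\<omega>. (\<Prod>i<n. indicator (B i) (\<omega> i)) * (indicator (B n) (\<omega> n) * (\<integral>\<^sup>+y. g y \<partial>K (\<omega> n))) \<partial>chain_law x)"
  proof (intro nn_integral_cong)
    fix \<omega> assume "\<omega> \<in> space (chain_law x)"
    then have "\<omega> n \<in> space M"
      by (auto simp: space_chain_law[OF x] space_PiM PiE_iff)
    then have "g \<in> borel_measurable (K (\<omega> n))"
      using Suc.prems by (subst measurable_cong_sets[OF sets_K refl])
    then show "(\<integral>\<^sup>+y. (\<Prod>i<Suc n. indicator (B i) (\<omega> i)) * g y \<partial>K (\<omega> n)) =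
      (\<Prod>i<n. indicator (B i) (\<omega> i)) * (indicator (B n) (\<omega> n) * (\<integral>\<^sup>+y. g y \<partial>K (\<omega> n)))"
      by (simp add: nn_integral_cmult mult.assoc)
  qed
  also have "\<dots> = cyl n B (\<lambda>x. indicator (B n) x * (\<integral>\<^sup>+y. g y \<partial>K x)) x"
    by (rule Suc.IH) measurable
  finally show ?case
    by (simp only: cyl_Suc_last)
qed

lemma emeasure_chain_law_cyl:
  assumes x: "x \<in> space M" and B: "\<And>i. B i \<in> sets M"
  shows "emeasure (chain_law x) {\<omega>\<in>space (PiM UNIV (\<lambda>_. M)). \<forall>i<n. \<omega> i \<in> B i} = cyl n B (\<lambda>_. 1) x"
proof -
  note [measurable] = B
  have "cyl n B (\<lambda>_. 1) x = (\<integral>\<^sup>+\<omega>. (\<Prod>i<n. indicator (B i) (\<omega> i)) * 1 \<partial>chain_law x)"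
    by (rule nn_integral_chain_law_cyl[symmetric, OF x B]) auto
  also have "\<dots> = (\<integral>\<^sup>+\<omega>. indicator {\<omega>\<in>space (PiM UNIV (\<lambda>_. M)). \<forall>i<n. \<omega> i \<in> B i} \<omega> \<partial>chain_law x)"
    by (intro nn_integral_cong)
      (auto simp: space_chain_law[OF x] indicator_def of_bool_def prod_eq_1_iff intro!: prod_zero)
  finally show ?thesis
    by (subst (asm) nn_integral_indicator) (auto simp: sets_chain_law[OF x])
qed

text \<open>Constraints on a finite index set are padded by the whole space to constraints on an
  initial segment. Inserting 0 gives the maximum a meaning when \<open>J\<close> is empty.\<close>

lemma prod_emb_cyl:
  assumes "finite J" "\<And>i. i \<in> J \<Longrightarrow> E i \<in> sets M"
  obtains n B where "range B \<subseteq> sets M"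
    "prod_emb UNIV (\<lambda>_. M) J (Pi\<^sub>E J E) = {\<omega>\<in>space (PiM UNIV (\<lambda>_. M)). \<forall>i<Suc n. \<omega> i \<in> B i}"
proof
  show "range (\<lambda>i. if i \<in> J then E i else space M) \<subseteq> sets M"
    using assms by auto
  have "i < Suc (Max (insert 0 J))" if "i \<in> J" for i
    using that assms(1) by (simp add: less_Suc_eq_le)
  then show "prod_emb UNIV (\<lambda>_. M) J (Pi\<^sub>E J E) =
    {\<omega>\<in>space (PiM UNIV (\<lambda>_. M)). \<forall>i<Suc (Max (insert 0 J)). \<omega> i \<in> (if i \<in> J then E i else space M)}"
    by (auto simp: prod_emb_def space_PiM PiE_iff split: if_splits)
qed

section \<open>Dependence on the start and decomposition at the first step\<close>

text \<open>It suffices to test an intersection-stable generator, and on cylinders the probability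
  is \<open>cyl\<close>, which is measurable in the start.\<close>

lemma measurable_chain_law [measurable]: "chain_law \<in> M \<rightarrow>\<^sub>M prob_algebra (PiM UNIV (\<lambda>_. M))"
proof (rule measurable_prob_algebra_generated[OF sets_PiM Int_stable_prod_algebra prod_algebra_sets_into_space])
  fix A :: "(nat \<Rightarrow> 'x) set" assume "A \<in> prod_algebra UNIV (\<lambda>_. M)"
  then obtain J E where J: "A = prod_emb UNIV (\<lambda>_. M) J (Pi\<^sub>E J E)" "finite J" "\<And>i. i \<in> J \<Longrightarrow> E i \<in> sets M"
    by (rule prod_algebraE) blast
  obtain n B where "range B \<subseteq> sets M" and
    A: "prod_emb UNIV (\<lambda>_. M) J (Pi\<^sub>E J E) = {\<omega>\<in>space (PiM UNIV (\<lambda>_. M)). \<forall>i<Suc n. \<omega> i \<in> B i}"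
    using J(2,3) by (rule prod_emb_cyl)
  then have B: "B i \<in> sets M" for i
    by auto
  show "(\<lambda>x. emeasure (chain_law x) A) \<in> borel_measurable M"
    unfolding J(1) A using measurable_cyl[OF B borel_measurable_const]
    by (subst measurable_cong[OF emeasure_chain_law_cyl[OF _ B]])
qed (auto simp: prob_space_chain_law sets_chain_law)

text \<open>The Markov property at time one: draw y from \<open>K x\<close>, run the chain from y
  and prepend x. Both sides agree on cylinders because \<open>cyl\<close> peels off the first step
  in the same way.\<close>

lemma chain_law_first_step:
  assumes x: "x \<in> space M"
  shows "chain_law x = K x \<bind> (\<lambda>y. distr (chain_law y) (PiM UNIV (\<lambda>_. M)) (case_nat x))"
proof (rule measure_eqI_PiM_infinite)
  let ?P = "PiM UNIV (\<lambda>_. M) :: (nat \<Rightarrow> 'x) measure"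
  note [measurable] = x
  have cons: "case_nat x \<in> ?P \<rightarrow>\<^sub>M ?P"
    by measurable
  have N: "(\<lambda>y. distr (chain_law y) ?P (case_nat x)) \<in> M \<rightarrow>\<^sub>M prob_algebra ?P"
    by (rule measurable_compose[OF measurable_chain_law measurable_distr_prob_space[OF cons]])
  have Kx: "K x \<in> space (prob_algebra M)"
    using K x by (rule measurable_space)
  show "sets (chain_law x) = sets ?P"
    using x by (rule sets_chain_law)
  show "sets (K x \<bind> (\<lambda>y. distr (chain_law y) ?P (case_nat x))) = sets ?P"
    using Kx N by (rule sets_bind')
  show "finite_measure (chain_law x)"
    using prob_space_chain_law[OF x] by (rule prob_space.finite_measure)
  fix E and J :: "nat set" assume J: "finite J" "\<And>i. i \<in> J \<Longrightarrow> E i \<in> sets M"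
  obtain n B where "range B \<subseteq> sets M" and
    A: "prod_emb UNIV (\<lambda>_. M) J (Pi\<^sub>E J E) = {\<omega>\<in>space ?P. \<forall>i<Suc n. \<omega> i \<in> B i}"
    using J by (rule prod_emb_cyl)
  then have B: "B i \<in> sets M" for i
    by auto
  note [measurable] = B
  have "emeasure (K x \<bind> (\<lambda>y. distr (chain_law y) ?P (case_nat x))) {\<omega>\<in>space ?P. \<forall>i<Suc n. \<omega> i \<in> B i} =
    (\<integral>\<^sup>+y. emeasure (distr (chain_law y) ?P (case_nat x)) {\<omega>\<in>space ?P. \<forall>i<Suc n. \<omega> i \<in> B i} \<partial>K x)"
    using Kx N by (rule emeasure_bind_prob_algebra) measurable
  also have "\<dots> = (\<integral>\<^sup>+y. indicator (B 0) x * cyl n (\<lambda>i. B (Suc i)) (\<lambda>_. 1) y \<partial>K x)"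
  proof (intro nn_integral_cong)
    fix y assume "y \<in> space (K x)"
    then have y: "y \<in> space M"
      by (simp add: space_K x)
    have "emeasure (distr (chain_law y) ?P (case_nat x)) {\<omega>\<in>space ?P. \<forall>i<Suc n. \<omega> i \<in> B i} =
      emeasure (chain_law y) (case_nat x -` {\<omega>\<in>space ?P. \<forall>i<Suc n. \<omega> i \<in> B i} \<inter> space ?P)"
      using cons by (subst emeasure_distr) (auto simp: measurable_cong_sets[OF sets_chain_law[OF y] refl] space_chain_law[OF y])
    \<comment> \<open>Prepending \<open>x\<close> makes the constraint at time 0 a condition on
      \<open>x\<close> alone and shifts all the others by one.\<close>
    also have "case_nat x -` {\<omega>\<in>space ?P. \<forall>i<Suc n. \<omega> i \<in> B i} \<inter> space ?P =
      (if x \<in> B 0 then {\<omega>\<in>space ?P. \<forall>i<n. \<omega> i \<in> B (Suc i)} else {})"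
      using measurable_space[OF cons] by (auto simp: less_Suc_eq_0_disj)
    finally show "emeasure (distr (chain_law y) ?P (case_nat x)) {\<omega>\<in>space ?P. \<forall>i<Suc n. \<omega> i \<in> B i} =
      indicator (B 0) x * cyl n (\<lambda>i. B (Suc i)) (\<lambda>_. 1) y"
      using emeasure_chain_law_cyl[OF y, of "\<lambda>i. B (Suc i)" n] B by auto
  qed
  also have "\<dots> = cyl (Suc n) B (\<lambda>_. 1) x"
    using measurable_cyl[of "\<lambda>i. B (Suc i)" "\<lambda>_. 1" n] B
    by (simp add: nn_integral_cmult measurable_cong_sets[OF sets_K[OF x] refl])
  also have "\<dots> = emeasure (chain_law x) {\<omega>\<in>space ?P. \<forall>i<Suc n. \<omega> i \<in> B i}"
    by (rule emeasure_chain_law_cyl[symmetric, OF x B])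
  finally show "emeasure (chain_law x) (prod_emb UNIV (\<lambda>_. M) J (Pi\<^sub>E J E)) =
    emeasure (K x \<bind> (\<lambda>y. distr (chain_law y) ?P (case_nat x))) (prod_emb UNIV (\<lambda>_. M) J (Pi\<^sub>E J E))"
    unfolding A ..
qed

text \<open>The start value is tested by a measurable function because singletons need not be measurable.\<close>

lemma AE_chain_law_start:
  fixes f :: "'x \<Rightarrow> real"
  assumes x: "x \<in> space M" and f [measurable]: "f \<in> borel_measurable M"
  shows "AE \<omega> in chain_law x. f (\<omega> 0) = f x"
proof -
  \<comment> \<open>For n = 0 the product is empty, leaving the integral of a function of the first
    coordinate.\<close>
  have "(\<integral>\<^sup>+\<omega>. (\<Prod>i<0. indicator {} (\<omega> i)) * indicator {y\<in>space M. f y \<noteq> f x} (\<omega> 0) \<partial>chain_law x) =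
    cyl 0 (\<lambda>_. {}) (indicator {y\<in>space M. f y \<noteq> f x}) x"
    using x by (rule nn_integral_chain_law_cyl) auto
  then have "(\<integral>\<^sup>+\<omega>. indicator {y\<in>space M. f y \<noteq> f x} (\<omega> 0) \<partial>chain_law x) = 0"
    by simp
  moreover have "(\<lambda>\<omega>. indicator {y\<in>space M. f y \<noteq> f x} (\<omega> 0) :: ennreal) \<in> borel_measurable (chain_law x)"
    unfolding measurable_cong_sets[OF sets_chain_law[OF x] refl] by measurable
  ultimately have "AE \<omega> in chain_law x. indicator {y\<in>space M. f y \<noteq> f x} (\<omega> 0) = (0::ennreal)"
    by (subst (asm) nn_integral_0_iff_AE) auto
  then show ?thesis
    using AE_space
  proof eventually_elim
    case (elim \<omega>)
    moreover have "\<omega> 0 \<in> space M"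
      using elim(2) by (auto simp: space_chain_law[OF x] space_PiM PiE_iff)
    ultimately show ?case
      by (auto simp: indicator_def split: if_splits)
  qed
qed

end

section \<open>The soft Bellman operator\<close>

locale soft_mdp =
  fixes S :: "'s measure" and A :: "'a measure" and \<mu> :: "'a measure"
    and P :: "'s \<times> 'a \<Rightarrow> 's measure" and R :: "'s \<Rightarrow> 'a \<Rightarrow> 's \<Rightarrow> real"
    and \<pi> :: "'s \<Rightarrow> 'a measure" and p :: "'s \<Rightarrow> 'a \<Rightarrow> real"
    and \<gamma> \<alpha> :: real
  assumes mdp: "discounted_mdp S A P R \<gamma>"
    and policy: "stationary_policy S A \<mu> \<pi> p"
begin

abbreviation SA :: "('s \<times> 'a) measure" where "SA \<equiv> S \<Otimes>\<^sub>M A"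

abbreviation K :: "'s \<times> 'a \<Rightarrow> ('s \<times> 'a) measure" where "K \<equiv> next_law S A P \<pi>"

abbreviation return_of :: "(nat \<Rightarrow> 's \<times> 'a) \<Rightarrow> real" where "return_of \<equiv> soft_return R \<gamma> \<alpha> p"

abbreviation law :: "'s \<times> 'a \<Rightarrow> real measure" where "law \<equiv> soft_return_law S A P R \<gamma> \<alpha> \<pi> p"

abbreviation T :: "('s \<times> 'a \<Rightarrow> real \<Rightarrow> real) \<Rightarrow> 's \<times> 'a \<Rightarrow> real \<Rightarrow> real" where
  "T \<equiv> T_cdf S A P R \<gamma> \<alpha> \<pi> p"

text \<open>
  Since \<open>(t - r) / \<gamma> + \<alpha> ln p = (t - (r - \<gamma> \<alpha> ln p)) / \<gamma>\<close>, collecting the reward and the entropy bonus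
  of the next action in one number turns the operator into a mixture of affine images of CDFs.
\<close>

definition soft_reward :: "'s \<times> 'a \<Rightarrow> 's \<times> 'a \<Rightarrow> real" where
  "soft_reward x y = R (fst x) (snd x) (fst y) - \<gamma> * \<alpha> * ln (p (fst y) (snd y))"

lemma gamma: "0 < \<gamma>" "\<gamma> < 1"
  using mdp by (auto simp: discounted_mdp_def)

sublocale markov_kernel SA K
proof
  have "(\<lambda>(s', a'). return SA (s', a')) \<in> SA \<rightarrow>\<^sub>M prob_algebra SA"
    using measurable_return_prob_space by (simp add: case_prod_eta)
  then have "(\<lambda>s'. \<pi> s' \<bind> (\<lambda>a'. return SA (s', a'))) \<in> S \<rightarrow>\<^sub>M prob_algebra SA"
    using policy by (intro measurable_bind_prob_space2) (auto simp: stationary_policy_def)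
  then show "K \<in> SA \<rightarrow>\<^sub>M prob_algebra SA"
    using mdp unfolding next_law_def[abs_def] discounted_mdp_def
    by (intro measurable_bind_prob_space) auto
qed

lemma trajectory_law_eq: "trajectory_law S A P \<pi> x = chain_law x"
proof -
  have "traj_kernel S A P \<pi> x = step x"
    by (simp add: fun_eq_iff traj_kernel_def step_def)
  then show ?thesis
    by (simp add: trajectory_law_def chain_law_def)
qed

lemma measurable_R [measurable (raw)]:
  assumes "f \<in> N \<rightarrow>\<^sub>M S" "g \<in> N \<rightarrow>\<^sub>M A" "h \<in> N \<rightarrow>\<^sub>M S"
  shows "(\<lambda>x. R (f x) (g x) (h x)) \<in> borel_measurable N"
proof -
  have "(\<lambda>(s, a, s'). R s a s') \<in> borel_measurable (S \<Otimes>\<^sub>M A \<Otimes>\<^sub>M S)"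
    using mdp by (simp add: discounted_mdp_def)
  from measurable_compose[OF measurable_Pair[OF assms(1) measurable_Pair[OF assms(2,3)]] this]
  show ?thesis by simp
qed

lemma measurable_p [measurable (raw)]:
  assumes "f \<in> N \<rightarrow>\<^sub>M S" "g \<in> N \<rightarrow>\<^sub>M A"
  shows "(\<lambda>x. p (f x) (g x)) \<in> borel_measurable N"
proof -
  have "(\<lambda>(s, a). p s a) \<in> borel_measurable SA"
    using policy by (simp add: stationary_policy_def)
  from measurable_compose[OF measurable_Pair[OF assms] this] show ?thesis
    by simp
qed

lemma measurable_soft_reward: "x \<in> space SA \<Longrightarrow> soft_reward x \<in> borel_measurable SA"
  unfolding soft_reward_def[abs_def] by (auto simp: space_pair_measure)

section \<open>The soft return and its law\<close>

lemma measurable_soft_return [measurable]: "return_of \<in> borel_measurable (PiM UNIV (\<lambda>_. SA))"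
  unfolding soft_return_def[abs_def] soft_term_def traj_reward_def by measurable

text \<open>The first summand for the longer path splits: its reward opens \<gamma> times the return
  of \<open>\<omega>\<close>, its entropy bonus goes into \<open>soft_reward\<close>. Convergence
  allows \<gamma> to be pulled out of the series.\<close>

lemma soft_return_case_nat:
  assumes "summable (soft_term R \<gamma> \<alpha> p \<omega>)"
  shows "return_of (case_nat x \<omega>) = soft_reward x (\<omega> 0) + \<gamma> * return_of \<omega>"
proof -
  let ?t = "soft_term R \<gamma> \<alpha> p"
  have Suc: "?t (case_nat x \<omega>) (Suc k) = \<gamma> * ?t \<omega> k" for k
    by (simp add: soft_term_def traj_reward_def)
  have "summable (?t (case_nat x \<omega>))"
    using summable_mult[OF assms, of \<gamma>] by (subst summable_Suc_iff[symmetric]) (simp add: Suc)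
  from suminf_split_head[OF this]
  have "(\<Sum>k. ?t (case_nat x \<omega>) k) = ?t (case_nat x \<omega>) 0 + \<gamma> * (\<Sum>k. ?t \<omega> k)"
    using suminf_mult[OF assms, of \<gamma>] by (simp add: Suc)
  then show ?thesis
    by (simp add: soft_return_def soft_reward_def soft_term_def traj_reward_def algebra_simps)
qed

lemma measurable_law: "law \<in> SA \<rightarrow>\<^sub>M prob_algebra borel"
  unfolding soft_return_law_def[abs_def] trajectory_law_eq
  by (rule measurable_compose[OF measurable_chain_law measurable_distr_prob_space]) measurable

lemma real_distribution_law:
  assumes "x \<in> space SA"
  shows "real_distribution (law x)"
proof -
  have "law x \<in> space (prob_algebra borel)"
    using measurable_law assms by (rule measurable_space)
  then show ?thesis
    by (auto simp: space_prob_algebra real_distribution_def real_distribution_axioms_def)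
qed

lemma emeasure_law:
  assumes "x \<in> space SA"
  shows "emeasure (chain_law x) {\<omega>\<in>space (PiM UNIV (\<lambda>_. SA)). return_of \<omega> \<le> t} = ennreal (cdf (law x) t)"
proof -
  interpret real_distribution "law x"
    using assms by (rule real_distribution_law)
  have "emeasure (law x) {..t} = emeasure (chain_law x) (return_of -` {..t} \<inter> space (chain_law x))"
    unfolding soft_return_law_def trajectory_law_eq
    by (rule emeasure_distr) (simp_all add: measurable_cong_sets[OF sets_chain_law[OF assms] refl])
  also have "return_of -` {..t} \<inter> space (chain_law x) = {\<omega>\<in>space (PiM UNIV (\<lambda>_. SA)). return_of \<omega> \<le> t}"
    using assms by (auto simp: space_chain_law)
  finally show ?thesis
    by (simp add: cdf_def emeasure_eq_measure)
qed

text \<open>Conditioning on the second pair y, \<open>chain_law_first_step\<close> and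
  \<open>soft_return_case_nat\<close> turn the event that the return is at most t into a threshold
  event for the return of a trajectory started at y.\<close>

lemma cdf_law_bellman:
  assumes x: "x \<in> space SA"
    and summable: "\<And>y. y \<in> space SA \<Longrightarrow> AE \<omega> in chain_law y. summable (soft_term R \<gamma> \<alpha> p \<omega>)"
  shows "cdf (law x) t = (\<integral>y. cdf (law y) ((t - soft_reward x y) / \<gamma>) \<partial>K x)"
proof -
  let ?P = "PiM UNIV (\<lambda>_. SA) :: (nat \<Rightarrow> 's \<times> 'a) measure"
  interpret Kx: prob_space "K x"
    using x by (rule prob_space_K)
  note [measurable] = x measurable_soft_reward[OF x]
  note [measurable_cong] = sets_K[OF x]
  have cons [measurable]: "case_nat x \<in> ?P \<rightarrow>\<^sub>M ?P"
    by measurable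
  have cdf: "is_cdf (cdf (law y))" if "y \<in> space (K x)" for y
    using that by (intro is_cdf_cdf real_distribution_law) (simp add: space_K[OF x])
  have meas: "(\<lambda>y. cdf (law y) s) \<in> borel_measurable SA" for s
    unfolding cdf_def by (rule measurable_compose[OF measurable_law]) simp
  have mix [measurable]: "(\<lambda>y. cdf (law y) ((t - soft_reward x y) / \<gamma>)) \<in> borel_measurable (K x)"
  proof -
    have "(\<lambda>(y, s). cdf (law y) ((s - soft_reward x y) / \<gamma>)) \<in> borel_measurable (K x \<Otimes>\<^sub>M borel)"
      using meas cdf by (intro Kx.measurable_affine_mixture gamma(1)) auto
    from measurable_compose[OF measurable_Pair2'[of t borel "K x"] this] show ?thesis
      by simp
  qed
  have "ennreal (cdf (law x) t) = emeasure (chain_law x) {\<omega>\<in>space ?P. return_of \<omega> \<le> t}"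
    by (rule emeasure_law[OF x, symmetric])
  also have "\<dots> = (\<integral>\<^sup>+y. emeasure (distr (chain_law y) ?P (case_nat x)) {\<omega>\<in>space ?P. return_of \<omega> \<le> t} \<partial>K x)"
    unfolding chain_law_first_step[OF x]
    by (rule emeasure_bind_prob_algebra[OF measurable_space[OF K x]
        measurable_compose[OF measurable_chain_law measurable_distr_prob_space[OF cons]]]) measurable
  also have "\<dots> = (\<integral>\<^sup>+y. ennreal (cdf (law y) ((t - soft_reward x y) / \<gamma>)) \<partial>K x)"
  proof (intro nn_integral_cong)
    fix y assume "y \<in> space (K x)"
    then have y: "y \<in> space SA"
      by (simp add: space_K x)
    note [measurable_cong] = sets_chain_law[OF y]
    have "emeasure (distr (chain_law y) ?P (case_nat x)) {\<omega>\<in>space ?P. return_of \<omega> \<le> t} =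
      emeasure (chain_law y) {\<omega>\<in>space ?P. return_of (case_nat x \<omega>) \<le> t}"
      using measurable_space[OF cons]
      by (subst emeasure_distr) (auto simp: space_chain_law[OF y] intro!: arg_cong[where f="emeasure _"])
    also have "\<dots> = emeasure (chain_law y) {\<omega>\<in>space ?P. return_of \<omega> \<le> (t - soft_reward x y) / \<gamma>}"
    proof (rule emeasure_eq_AE)
      \<comment> \<open>The recursion contains \<open>soft_reward x (\<omega> 0)\<close>; almost
        surely this equals \<open>soft_reward x y\<close>, a statement that avoids the event
        \<open>\<omega> 0 = y\<close>.\<close>
      show "AE \<omega> in chain_law y. \<omega> \<in> {\<omega>\<in>space ?P. return_of (case_nat x \<omega>) \<le> t} \<longleftrightarrow>
        \<omega> \<in> {\<omega>\<in>space ?P. return_of \<omega> \<le> (t - soft_reward x y) / \<gamma>}"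
        using summable[OF y] AE_chain_law_start[OF y measurable_soft_reward[OF x]]
      proof eventually_elim
        case (elim \<omega>)
        then show ?case
          using gamma(1) by (simp add: soft_return_case_nat field_simps)
      qed
    qed measurable
    also have "\<dots> = ennreal (cdf (law y) ((t - soft_reward x y) / \<gamma>))"
      by (rule emeasure_law[OF y])
    finally show "emeasure (distr (chain_law y) ?P (case_nat x)) {\<omega>\<in>space ?P. return_of \<omega> \<le> t} =
      ennreal (cdf (law y) ((t - soft_reward x y) / \<gamma>))" .
  qed
  also have "\<dots> = ennreal (\<integral>y. cdf (law y) ((t - soft_reward x y) / \<gamma>) \<partial>K x)"
    using is_cdf_nonneg[OF cdf] is_cdf_le_1[OF cdf]
    by (intro nn_integral_eq_integral Kx.integrable_const_bound[of _ 1]) auto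
  finally show ?thesis
    using is_cdf_nonneg[OF is_cdf_cdf[OF real_distribution_law[OF x]]] is_cdf_nonneg[OF cdf]
    by (subst (asm) ennreal_inj) (auto intro!: Bochner_Integration.integral_nonneg_AE)
qed

section \<open>The operator on CDF fields\<close>

lemma T_eq: "T F = (\<lambda>x\<in>space SA. \<lambda>t. \<integral>y. F y ((t - soft_reward x y) / \<gamma>) \<partial>K x)"
  using gamma(1)
  by (auto simp: T_cdf_def restrict_def fun_eq_iff soft_reward_def case_prod_beta field_simps
      intro!: Bochner_Integration.integral_cong arg_cong2[where f=F])

lemma T_apply: "x \<in> space SA \<Longrightarrow> T F x = (\<lambda>t. \<integral>y. F y ((t - soft_reward x y) / \<gamma>) \<partial>K x)"
  by (simp add: T_eq)

lemma T_F_Z: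
  assumes "\<And>x. x \<in> space SA \<Longrightarrow> AE \<omega> in trajectory_law S A P \<pi> x. summable (soft_term R \<gamma> \<alpha> p \<omega>)"
  shows "T (F_Z S A P R \<gamma> \<alpha> \<pi> p) = F_Z S A P R \<gamma> \<alpha> \<pi> p"
proof (rule extensionalityI)
  show "T (F_Z S A P R \<gamma> \<alpha> \<pi> p) \<in> extensional (space SA)" "F_Z S A P R \<gamma> \<alpha> \<pi> p \<in> extensional (space SA)"
    by (simp_all add: T_eq F_Z_def)
  fix x assume x: "x \<in> space SA"
  have "T (F_Z S A P R \<gamma> \<alpha> \<pi> p) x t = (\<integral>y. cdf (law y) ((t - soft_reward x y) / \<gamma>) \<partial>K x)" for t
    unfolding T_apply[OF x] by (rule Bochner_Integration.integral_cong) (auto simp: F_Z_def space_K[OF x])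
  moreover have "(\<integral>y. cdf (law y) ((t - soft_reward x y) / \<gamma>) \<partial>K x) = cdf (law x) t" for t
    by (rule cdf_law_bellman[OF x assms[unfolded trajectory_law_eq], symmetric])
  ultimately show "T (F_Z S A P R \<gamma> \<alpha> \<pi> p) x = F_Z S A P R \<gamma> \<alpha> \<pi> p x"
    using x by (simp add: F_Z_def fun_eq_iff)
qed

text \<open>The uniform bound \<open>B\<close> for \<open>F\<close> and the uniform first absolute
  moment \<open>C\<close> of the soft reward combine to a bound independent of the starting
  pair.\<close>

lemma T_in_X_cdf:
  assumes b: "(SUP x\<in>space SA. \<integral>\<^sup>+y. ennreal \<bar>soft_reward x y\<bar> \<partial>K x) < top"
    and meas: "\<And>t. (\<lambda>x. T F x t) \<in> borel_measurable SA"
    and F: "F \<in> X_cdf S A"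
  shows "T F \<in> X_cdf S A"
proof -
  define C where "C = (SUP x\<in>space SA. \<integral>\<^sup>+y. ennreal \<bar>soft_reward x y\<bar> \<partial>K x)"
  obtain B where B: "B < top" "\<And>x. x \<in> space SA \<Longrightarrow> sq_dist (F x) (indicator {0..}) \<le> B"
    using F by (auto simp: X_cdf_iff)
  have *: "is_cdf (T F x) \<and> sq_dist (T F x) (indicator {0..}) \<le> 2 * (ennreal \<gamma> * B) + 2 * C"
    if x: "x \<in> space SA" for x
  proof -
    interpret prob_space "K x"
      using x by (rule prob_space_K)
    note [measurable] = measurable_soft_reward[OF x]
    note [measurable_cong] = sets_K[OF x]
    have Fx: "(\<lambda>y. F y t) \<in> borel_measurable (K x)" "y \<in> space (K x) \<Longrightarrow> is_cdf (F y)" for y t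
      using F by (simp_all add: X_cdf_iff measurable_cong_sets[OF sets_K[OF x] refl] space_K[OF x])
    have c: "soft_reward x \<in> borel_measurable (K x)"
      by measurable
    have "sq_dist (T F x) (indicator {0..}) \<le>
        (\<integral>\<^sup>+y. 2 * (ennreal \<gamma> * sq_dist (F y) (indicator {0..})) + 2 * ennreal \<bar>soft_reward x y\<bar> \<partial>K x)"
      unfolding T_apply[OF x] by (rule sq_dist_affine_mixture_step[OF Fx c gamma(1)])
    also have "\<dots> \<le> (\<integral>\<^sup>+y. 2 * (ennreal \<gamma> * B) + 2 * ennreal \<bar>soft_reward x y\<bar> \<partial>K x)"
      using B(2) by (intro nn_integral_mono add_right_mono mult_left_mono) (auto simp: space_K[OF x])
    also have "\<dots> = 2 * (ennreal \<gamma> * B) + 2 * (\<integral>\<^sup>+y. ennreal \<bar>soft_reward x y\<bar> \<partial>K x)"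
      by (simp add: nn_integral_add nn_integral_cmult emeasure_space_1)
    also have "\<dots> \<le> 2 * (ennreal \<gamma> * B) + 2 * C"
      unfolding C_def using x by (intro add_left_mono mult_left_mono SUP_upper) auto
    finally show ?thesis
      unfolding T_apply[OF x] using is_cdf_affine_mixture[OF Fx c gamma(1)] by blast
  qed
  have "2 * (ennreal \<gamma> * B) + 2 * C < top"
    using b B(1) by (simp add: C_def ennreal_mult_less_top)
  with * meas show ?thesis
    unfolding X_cdf_iff
    by (intro conjI ballI allI exI[of _ "2 * (ennreal \<gamma> * B) + 2 * C"]) (simp_all add: T_eq[of F])
qed

lemma d_Cr_T_le:
  assumes F: "F \<in> X_cdf S A" and G: "G \<in> X_cdf S A"
  shows "d_Cr S A (T F) (T G) \<le> ennreal (sqrt \<gamma>) * d_Cr S A F G"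
  unfolding d_Cr_le_iff
proof
  let ?D = "d_Cr S A F G"
  fix x assume x: "x \<in> space SA"
  interpret prob_space "K x"
    using x by (rule prob_space_K)
  have [simp]: "(\<lambda>y. F y t) \<in> borel_measurable (K x)" "(\<lambda>y. G y t) \<in> borel_measurable (K x)"
    "soft_reward x \<in> borel_measurable (K x)" for t
    using F G measurable_soft_reward[OF x] by (simp_all add: X_cdf_iff measurable_cong_sets[OF sets_K[OF x] refl])
  have "sq_dist (T F x) (T G x) \<le> (\<integral>\<^sup>+y. ennreal \<gamma> * sq_dist (F y) (G y) \<partial>K x)"
    unfolding T_apply[OF x] using F G gamma(1)
    by (intro sq_dist_affine_mixture) (auto simp: X_cdf_iff space_K[OF x])
  also have "\<dots> \<le> (\<integral>\<^sup>+y. ennreal \<gamma> * ?D\<^sup>2 \<partial>K x)"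
    using d_Cr_le_iff[of S A F G ?D] by (intro nn_integral_mono mult_left_mono) (auto simp: space_K[OF x])
  \<comment> \<open>\<open>K x\<close> has total mass 1, so the constant \<gamma> D^2 integrates to
    itself; it is the square of sqrt \<gamma> times D.\<close>
  also have "\<dots> = (ennreal (sqrt \<gamma>) * ?D)\<^sup>2"
    using gamma(1) by (simp add: emeasure_space_1 power_mult_distrib ennreal_power)
  finally show "sq_dist (T F x) (T G x) \<le> (ennreal (sqrt \<gamma>) * ?D)\<^sup>2" .
qed

end

section \<open>Unique fixed point and geometric convergence\<close>

theorem corollary11:
  fixes S :: "'s measure" and A :: "'a measure" and \<mu> :: "'a measure"
    and P :: "'s \<times> 'a \<Rightarrow> 's measure" and R :: "'s \<Rightarrow> 'a \<Rightarrow> 's \<Rightarrow> real"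
    and \<pi> :: "'s \<Rightarrow> 'a measure" and p :: "'s \<Rightarrow> 'a \<Rightarrow> real"
    and \<gamma> \<alpha> :: real
    and F :: "nat \<Rightarrow> 's \<times> 'a \<Rightarrow> real \<Rightarrow> real"
  assumes mdp: "discounted_mdp S A P R \<gamma>"
    and alpha: "0 < \<alpha>"
    and policy: "stationary_policy S A \<mu> \<pi> p"
    and return_converges:
      "\<And>sa. sa \<in> space (S \<Otimes>\<^sub>M A) \<Longrightarrow>
         AE \<omega> in trajectory_law S A P \<pi> sa. summable (soft_term R \<gamma> \<alpha> p \<omega>)"
    and a: "\<And>s. s \<in> space S \<Longrightarrow> AE a in \<pi> s. 0 < p s a"
    and b: "(SUP (s, a)\<in>space (S \<Otimes>\<^sub>M A).
         \<integral>\<^sup>+(s', a'). ennreal \<bar>R s a s' - \<gamma> * \<alpha> * ln (p s' a')\<bar> \<partial>next_law S A P \<pi> (s, a)) < \<infinity>"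
    and c: "\<And>G x. G \<in> X_cdf S A \<Longrightarrow>
         (\<lambda>(s, a). \<integral>(s', a'). G (s', a') ((x - R s a s') / \<gamma> + \<alpha> * ln (p s' a'))
            \<partial>next_law S A P \<pi> (s, a)) \<in> borel_measurable (S \<Otimes>\<^sub>M A)"
    and d: "F_Z S A P R \<gamma> \<alpha> \<pi> p \<in> X_cdf S A"
    and F_0: "F 0 \<in> X_cdf S A"
    and F_Suc: "\<And>k. F (Suc k) = T_cdf S A P R \<gamma> \<alpha> \<pi> p (F k)"
  shows "(\<forall>G. G \<in> X_cdf S A \<and> T_cdf S A P R \<gamma> \<alpha> \<pi> p G = G \<longleftrightarrow> G = F_Z S A P R \<gamma> \<alpha> \<pi> p) \<and>
    (\<forall>k. F k \<in> X_cdf S A) \<and>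
    ((\<lambda>k. d_Cr S A (F k) (F_Z S A P R \<gamma> \<alpha> \<pi> p)) \<longlonglongrightarrow> 0) \<and>
    (\<forall>k. d_Cr S A (F k) (F_Z S A P R \<gamma> \<alpha> \<pi> p)
           \<le> ennreal (sqrt \<gamma> ^ k) * d_Cr S A (F 0) (F_Z S A P R \<gamma> \<alpha> \<pi> p))"
proof -
  interpret soft_mdp S A \<mu> P R \<pi> p \<gamma> \<alpha>
    using mdp policy by (rule soft_mdp.intro)
  define Z where "Z = F_Z S A P R \<gamma> \<alpha> \<pi> p"
  have Z: "Z \<in> X_cdf S A"
    unfolding Z_def by (rule d)
  have T_Z: "T Z = Z"
    unfolding Z_def using return_converges by (rule T_F_Z)
  have T: "T G \<in> X_cdf S A" if "G \<in> X_cdf S A" for G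
  proof (rule T_in_X_cdf[OF _ _ that])
    show "(SUP x\<in>space SA. \<integral>\<^sup>+y. ennreal \<bar>soft_reward x y\<bar> \<partial>K x) < top"
      using b by (simp add: soft_reward_def case_prod_unfold)
    show "(\<lambda>x. T G x t) \<in> borel_measurable SA" for t
      \<comment> \<open>The function in (c) and \<open>T G\<close> agree on the state-action space,
        where measurability is tested; outside it \<open>T G\<close> has the default value of
        \<open>restrict\<close>.\<close>
      using c[OF that, of t] by (rule measurable_cong[THEN iffD1, rotated]) (auto simp: T_cdf_def)
  qed
  have F: "F k \<in> X_cdf S A" for k
    by (induction k) (simp_all add: F_0 F_Suc T)
  have contract: "d_Cr S A (T G) Z \<le> ennreal (sqrt \<gamma>) * d_Cr S A G Z" if "G \<in> X_cdf S A" for G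
    using d_Cr_T_le[OF that Z] by (simp only: T_Z)
  have unique: "G = Z" if G: "G \<in> X_cdf S A" "T G = G" for G
  proof (rule d_Cr_eq_0_imp_eq[OF G(1) Z])
    \<comment> \<open>The distance must be finite here: in \<open>ennreal\<close> an infinite one
      would also satisfy d \<le> sqrt \<gamma> d.\<close>
    obtain r where r: "0 \<le> r" "d_Cr S A G Z = ennreal r"
      using d_Cr_finite[OF G(1) Z] by (cases "d_Cr S A G Z") auto
    have "ennreal r \<le> ennreal (sqrt \<gamma> * r)"
      using contract[OF G(1)] r gamma(1) by (simp add: G(2) ennreal_mult)
    then have "r \<le> sqrt \<gamma> * r"
      using r gamma(1) by (subst (asm) ennreal_le_iff) auto
    moreover have "sqrt \<gamma> < 1"
      using gamma(2) by simp
    ultimately have "r = 0"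
      using r(1) mult_strict_right_mono[of "sqrt \<gamma>" 1 r] by (cases "r = 0") auto
    with r show "d_Cr S A G Z = 0"
      by simp
  qed
  have rate: "d_Cr S A (F k) Z \<le> ennreal (sqrt \<gamma> ^ k) * d_Cr S A (F 0) Z" for k
  proof (induction k)
    case (Suc k)
    have "d_Cr S A (F (Suc k)) Z \<le> ennreal (sqrt \<gamma>) * d_Cr S A (F k) Z"
      unfolding F_Suc using F by (rule contract)
    also have "\<dots> \<le> ennreal (sqrt \<gamma>) * (ennreal (sqrt \<gamma> ^ k) * d_Cr S A (F 0) Z)"
      using Suc by (rule mult_left_mono) simp
    finally show ?case
      using gamma(1) by (simp add: ennreal_mult mult.assoc)
  qed simp
  have "(\<lambda>k. d_Cr S A (F k) Z) \<longlonglongrightarrow> 0"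
  proof (rule tendsto_sandwich[OF _ _ tendsto_const])
    \<comment> \<open>A finite initial distance makes the geometric upper bound tend to 0.\<close>
    obtain r where r: "0 \<le> r" "d_Cr S A (F 0) Z = ennreal r"
      using d_Cr_finite[OF F_0 Z] by (cases "d_Cr S A (F 0) Z") auto
    have "(\<lambda>k. sqrt \<gamma> ^ k * r) \<longlonglongrightarrow> 0"
      using gamma by (intro tendsto_mult_left_zero LIMSEQ_realpow_zero) auto
    then have "(\<lambda>k. ennreal (sqrt \<gamma> ^ k * r)) \<longlonglongrightarrow> ennreal 0"
      by (rule tendsto_ennrealI)
    then show "(\<lambda>k. ennreal (sqrt \<gamma> ^ k) * d_Cr S A (F 0) Z) \<longlonglongrightarrow> 0"
      using r gamma(1) by (simp add: ennreal_mult)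
  qed (simp_all add: rate)
  with F rate unique Z T_Z show ?thesis
    unfolding Z_def by blast
qed

end
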